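(* Let $\lambda\ge0$, $T>0$, and let $u_{0,1},u_{0,2}$ be finite Dirac mixtures on $\mathbb{R}^d$ with supports $A_1,A_2$. Let $x_T\in\mathbb{R}^d$, let $X=(X_t)_{t\in(0,T]}$ be the solution of $\dot X_t=-\nabla V_\lambda(X_t,t)$, $t\in(0,T]$, with $X_T=x_T$, and let $Y_\tau:=X_{Te^{-\tau}}$, $\tau\ge0$. Assume that $\omega_\tau(Y)\cap(\mathrm{Crit}(\Phi_\lambda)\setminus\mathrm{Min}(\Phi_\lambda))=\varnothing$ if $0\le\lambda\le1$, and $\omega_\tau(Y)\cap(\mathrm{Crit}_{\mathrm{out}}(\Phi_\lambda)\setminus\mathrm{Min}(\Phi_\lambda))=\varnothing$ if $\lambda>1$. Let $x^\ast\in\mathrm{Min}(\Phi_\lambda)$ be the limit of $Y_\tau$ as $\tau\to\infty$ (which exists under these hypotheses). 1. If $0\le\lambda\le1$, then $x^\ast$ is automatically a smooth minimizer of $\Phi_\lambda$ (i.e. $\Phi_\lambda$ is smooth in a neighborhood of $x^\ast$), and there exists a constant $C>0$ such that $\|Y_\tau-x^\ast\|\le Ce^{-\tau/2}$ for all $\tau\ge0$; equivalently (up to changing the constant $C$), $\|X_t-x^\ast\|\le C\sqrt t$ for all $t\in(0,T]$. 2. If $\lambda>1$ and in addition $x^\ast\notin\mathrm{ND}(A_1,A_2)$, then there exists a constant $C>0$ such that $\|Y_\tau-x^\ast\|\le Ce^{-\tau/2}$ for all $\tau\ge0$; equivalently (up to changing the constant $C$), $\|X_t-x^\ast\|\le C\sqrt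 t$ for all $t\in(0,T]$.
   Context: A finite Dirac mixture on $\mathbb{R}^d$ is a probability measure $\sum_{k=1}^n w_k\delta_{a_k}$ with $n\ge1$, $a_k\in\mathbb{R}^d$, $w_k>0$, $\sum_k w_k=1$. Its support is $\{a_1,\dots,a_n\}$. Heat flows: for $i=1,2$ and $t>0$, $u_i(\cdot,t)=G_t*u_{0,i}$ with $G_t(z)=(4\pi t)^{-d/2}e^{-\|z\|^2/(4t)}$. Set $V_\lambda(x,t)=\lambda\log u_1(x,t)+(1-\lambda)\log u_2(x,t)$; $\nabla$ is the gradient in $x$. Geometric potential: $A_i=\mathrm{supp}(u_{0,i})$, $d_i(x)=\mathrm{dist}(x,A_i)$, $\Phi_\lambda(x)=\lambda d_1(x)^2+(1-\lambda)d_2(x)^2$. Clarke subdifferential of a locally Lipschitz $f:\mathbb{R}^d\to\mathbb{R}$: $\partial^Cf(x)=\mathrm{conv}\{\lim_k\nabla f(x_k): x_k\to x,\ f \text{ differentiable at each } x_k\}$ (over all sequences for which the limit exists). Outer Clarke subdifferential of $\Phi_\lambda$: $\widehat{\partial}\Phi_\lambda(x)=\lambda\,\partial^C(d_1^2)(x)+(1-\lambda)\,\partial^C(d_2^2)(x)$ (Minkowski sum). $\mathrm{ND}(f)=\{x:\partial^Cf(x)\text{ is not a singleton}\}$ and $\mathrm{ND}(A_1,A_2)=\mathrm{ND}(d_1^2)\cup\mathrm{ND}(d_2^2)$. $\mathrm{Crit}(\Phi_\lambda)=\{x:0\in\partial^C\Phi_\lambda(x)\}$, $\mathrm{Crit}_{\mathrm{out}}(\Phi_\lambda)=\{x:0\in\widehat{\partial}\Phi_\lambda(x)\}$,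 and $\mathrm{Min}(\Phi_\lambda)$ is the set of local minimizers of $\Phi_\lambda$ in $\mathbb{R}^d$. $\omega_\tau(Y)=\{y^\ast\in\mathbb{R}^d:\exists\,\tau_n\to\infty\text{ with }Y_{\tau_n}\to y^\ast\}$. *)

theory Defs
  imports "HOL-Probability.Probability"
begin

text \<open>Euclidean space $\mathbb{R}^d$ is an arbitrary type of class \<open>euclidean_space\<close>,
  with $d$ = \<open>DIM('a)\<close>.\<close>

section \<open>Finite Dirac mixtures and their heat flows\<close>

text \<open>The atoms \<open>a k\<close> need not be distinct; \<open>return borel a\<close> is the Dirac measure at \<open>a\<close>.\<close>

definition finite_dirac_mixture :: "'a::euclidean_space measure \<Rightarrow> bool" where
  "finite_dirac_mixture \<mu> \<longleftrightarrow>
     sets \<mu> = sets borel \<and>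
     (\<exists>n\<ge>1. \<exists>(a :: nat \<Rightarrow> 'a) (w :: nat \<Rightarrow> real).
        (\<forall>k<n. 0 < w k) \<and> (\<Sum>k<n. w k) = 1 \<and>
        (\<forall>B\<in>sets borel. emeasure \<mu> B = (\<Sum>k<n. ennreal (w k) * emeasure (return borel (a k)) B)))"

definition supp :: "'a::euclidean_space measure \<Rightarrow> 'a set" where
  "supp \<mu> = {x. \<forall>U. open U \<and> x \<in> U \<longrightarrow> 0 < emeasure \<mu> U}"

lemma supp_finite_dirac_mixture:
  fixes a :: "nat \<Rightarrow> 'a::euclidean_space" and w :: "nat \<Rightarrow> real"
  assumes w: "\<And>k. k < n \<Longrightarrow> 0 < w k"
    and mu: "\<And>B. B \<in> sets borel \<Longrightarrow>
      emeasure \<mu> B = (\<Sum>k<n. ennreal (w k) * emeasure (return borel (a k)) B)"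
  shows "supp \<mu> = a ` {..<n}"
proof -
  have pos: "0 < emeasure \<mu> U \<longleftrightarrow> (\<exists>k<n. a k \<in> U)" if "open U" for U
  proof -
    have "emeasure \<mu> U = (\<Sum>k<n. ennreal (w k) * indicator U (a k))"
      using that by (simp add: mu)
    moreover have "\<dots> = 0 \<longleftrightarrow> (\<forall>k<n. a k \<notin> U)"
      using w by (subst sum_eq_0_iff) (auto simp: ennreal_eq_0_iff indicator_eq_0_iff dest: leD)
    ultimately show ?thesis
      by (auto simp: zero_less_iff_neq_zero)
  qed
  show ?thesis
  proof (intro equalityI subsetI)
    fix x assume x: "x \<in> supp \<mu>"
    show "x \<in> a ` {..<n}"
    proof (rule ccontr)
      assume "x \<notin> a ` {..<n}"
      moreover have "open (- (a ` {..<n}))"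
        by (intro open_Compl finite_imp_closed) auto
      ultimately have "0 < emeasure \<mu> (- (a ` {..<n}))"
        using x by (auto simp: supp_def)
      then show False
        using pos[OF \<open>open (- (a ` {..<n}))\<close>] by auto
    qed
  qed (auto simp: supp_def pos)
qed

definition heat_kernel :: "real \<Rightarrow> 'a::euclidean_space \<Rightarrow> real" where
  "heat_kernel t z = (4 * pi * t) powr (- real DIM('a) / 2) * exp (- (norm z)\<^sup>2 / (4 * t))"

definition heat_flow :: "'a::euclidean_space measure \<Rightarrow> 'a \<Rightarrow> real \<Rightarrow> real" where
  "heat_flow \<mu> x t = (\<integral>y. heat_kernel t (x - y) \<partial>\<mu>)"

definition V :: "real \<Rightarrow> 'a::euclidean_space measure \<Rightarrow> 'a measure \<Rightarrow> 'a \<Rightarrow> real \<Rightarrow> real" where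
  "V lam \<mu>1 \<mu>2 x t = lam * ln (heat_flow \<mu>1 x t) + (1 - lam) * ln (heat_flow \<mu>2 x t)"

section \<open>Gradients, smoothness and Clarke subdifferentials\<close>

text \<open>Only meaningful where \<open>f\<close> is differentiable.\<close>

definition grad :: "('a::euclidean_space \<Rightarrow> real) \<Rightarrow> 'a \<Rightarrow> 'a" where
  "grad f x = (THE D. GDERIV f x :> D)"

text \<open>$C^k$ regularity on an open set, by recursion on directional derivatives.\<close>

primrec Ck_on :: "nat \<Rightarrow> ('a::euclidean_space \<Rightarrow> real) \<Rightarrow> 'a set \<Rightarrow> bool" where
  "Ck_on 0 f U \<longleftrightarrow> continuous_on U f"
| "Ck_on (Suc k) f U \<longleftrightarrow>
     (\<forall>x\<in>U. f differentiable (at x)) \<and>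
     (\<forall>v. Ck_on k (\<lambda>x. frechet_derivative f (at x) v) U)"

definition smooth_near :: "('a::euclidean_space \<Rightarrow> real) \<Rightarrow> 'a \<Rightarrow> bool" where
  "smooth_near f x \<longleftrightarrow> (\<exists>U. open U \<and> x \<in> U \<and> (\<forall>k. Ck_on k f U))"

definition clarke :: "('a::euclidean_space \<Rightarrow> real) \<Rightarrow> 'a \<Rightarrow> 'a set" where
  "clarke f x = convex hull
     {v. \<exists>xs :: nat \<Rightarrow> 'a. xs \<longlonglongrightarrow> x \<and> (\<forall>k. f differentiable (at (xs k))) \<and>
           (\<lambda>k. grad f (xs k)) \<longlonglongrightarrow> v}"

definition ND :: "('a::euclidean_space \<Rightarrow> real) \<Rightarrow> 'a set" where
  "ND f = {x. \<not> is_singleton (clarke f x)}"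

section \<open>The geometric potential\<close>

definition sqdist :: "'a::euclidean_space set \<Rightarrow> 'a \<Rightarrow> real" where
  "sqdist A x = (infdist x A)\<^sup>2"

definition Phi :: "real \<Rightarrow> 'a::euclidean_space set \<Rightarrow> 'a set \<Rightarrow> 'a \<Rightarrow> real" where
  "Phi lam A1 A2 x = lam * sqdist A1 x + (1 - lam) * sqdist A2 x"

definition clarke_outer :: "real \<Rightarrow> 'a::euclidean_space set \<Rightarrow> 'a set \<Rightarrow> 'a \<Rightarrow> 'a set" where
  "clarke_outer lam A1 A2 x =
     {lam *\<^sub>R v + (1 - lam) *\<^sub>R w | v w. v \<in> clarke (sqdist A1) x \<and> w \<in> clarke (sqdist A2) x}"

definition ND_pair :: "'a::euclidean_space set \<Rightarrow> 'a set \<Rightarrow> 'a set" where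
  "ND_pair A1 A2 = ND (sqdist A1) \<union> ND (sqdist A2)"

definition Crit :: "real \<Rightarrow> 'a::euclidean_space set \<Rightarrow> 'a set \<Rightarrow> 'a set" where
  "Crit lam A1 A2 = {x. 0 \<in> clarke (Phi lam A1 A2) x}"

definition Crit_out :: "real \<Rightarrow> 'a::euclidean_space set \<Rightarrow> 'a set \<Rightarrow> 'a set" where
  "Crit_out lam A1 A2 = {x. 0 \<in> clarke_outer lam A1 A2 x}"

definition Min_loc :: "real \<Rightarrow> 'a::euclidean_space set \<Rightarrow> 'a set \<Rightarrow> 'a set" where
  "Min_loc lam A1 A2 = {x. \<forall>\<^sub>F y in nhds x. Phi lam A1 A2 x \<le> Phi lam A1 A2 y}"

section \<open>The time-reversed flow and its limit set\<close>

text \<open>The derivative at the endpoint \<open>T\<close> is one-sided; values of \<open>X\<close> outside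
  \<open>{0<..T}\<close> are irrelevant.\<close>

definition solves_flow ::
  "real \<Rightarrow> 'a::euclidean_space measure \<Rightarrow> 'a measure \<Rightarrow> real \<Rightarrow> (real \<Rightarrow> 'a) \<Rightarrow> bool" where
  "solves_flow lam \<mu>1 \<mu>2 T X \<longleftrightarrow>
     (\<forall>t\<in>{0<..T}. (X has_vector_derivative - grad (\<lambda>x. V lam \<mu>1 \<mu>2 x t) (X t)) (at t within {0<..T}))"

definition log_time :: "real \<Rightarrow> (real \<Rightarrow> 'a) \<Rightarrow> real \<Rightarrow> 'a" where
  "log_time T X \<tau> = X (T * exp (- \<tau>))"

definition omega_limit :: "(real \<Rightarrow> 'a::euclidean_space) \<Rightarrow> 'a set" where
  "omega_limit Y = {y. \<exists>\<tau> :: nat \<Rightarrow> real. filterlim \<tau> at_top sequentially \<and> (\<lambda>n. Y (\<tau> n)) \<longlonglongrightarrow> y}"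

end

theory Submission imports Defs begin

text \<open>In logarithmic time the flow reads \<open>Y' = - (Y - c) / 2\<close>, where
  \<open>c = \<lambda> m\<^sub>1 + (1 - \<lambda>) m\<^sub>2\<close> and \<open>m\<^sub>i\<close> is the Gibbs mean of the atoms of \<open>u\<^sub>0\<^sub>,\<^sub>i\<close> at inverse
  temperature \<open>s = 1 / (4 t)\<close>. The softened potential \<open>- 4 t V\<close> dissipates along \<open>Y\<close> up to an
  error \<open>O(exp (- \<tau>))\<close>, so near any limit point there are times with \<open>Y' \<rightarrow> 0\<close>; since \<open>m\<^sub>i\<close> is
  within \<open>O(1 / s)\<close> of the hull of the nearest atoms, limit points are critical, hence local
  minimizers by hypothesis. There are only finitely many local minimizers: for \<open>\<lambda> \<le> 1\<close> each is the
  centre of every active paraboloid of \<open>\<Phi>\<close>, and for \<open>\<lambda> > 1\<close> it is the unique minimizer of a strongly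
  convex function attached to a single atom. So \<open>Y\<close> converges. When all nearest atoms combine to the
  limit itself, \<open>c - x\<^sup>* = O(exp (- \<tau>))\<close> and Duhamel's formula gives the rate.\<close>

section \<open>Lower envelopes of paraboloids\<close>

text \<open>The obstacle: at each time the flow follows a smooth potential that itself moves, while
  limit points see only the nonsmooth \<Phi>. At a fixed point the softened squared distance drifts
  in \<tau> at rate (entropy defect)/s. The defect is bounded uniformly in s and x and s grows like
  exp \<tau>, so the total drift is finite. Finite total dissipation says nothing about prescribed
  times, so sampling times are shifted by a vanishing amount, which a Lipschitz bound on Y makes
  harmless. The split at \<lambda> = 1 is one of signs. With both weights nonnegative, \<Phi> is a
  minimum of unit paraboloids indexed by pairs of atoms, and pairs of nearest atoms are active, so
  criticality holds for \<Phi> itself. For \<lambda> > 1 the second term is a maximum; the two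
  squared distances are then treated separately, which yields outer criticality. The rate exp (-
  \<tau> / 2) is that of the homogeneous equation Y' = - Y / 2; forcing of size exp (- \<tau>)
  decays faster and costs only a constant.\<close>

definition lower_envelope ::
  "'i set \<Rightarrow> ('i \<Rightarrow> 'a::euclidean_space) \<Rightarrow> ('i \<Rightarrow> real) \<Rightarrow> ('a \<Rightarrow> real) \<Rightarrow> bool" where
  "lower_envelope I c \<beta> f \<longleftrightarrow>
     (\<forall>x. (\<forall>i\<in>I. f x \<le> (norm (x - c i))\<^sup>2 + \<beta> i) \<and> (\<exists>i\<in>I. f x = (norm (x - c i))\<^sup>2 + \<beta> i))"

definition active ::
  "'i set \<Rightarrow> ('i \<Rightarrow> 'a::euclidean_space) \<Rightarrow> ('i \<Rightarrow> real) \<Rightarrow> ('a \<Rightarrow> real) \<Rightarrow> 'a \<Rightarrow> 'i set" where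
  "active I c \<beta> f y = {i\<in>I. f y = (norm (y - c i))\<^sup>2 + \<beta> i}"

lemma GDERIV_unique: "GDERIV f x :> D \<Longrightarrow> GDERIV f x :> E \<Longrightarrow> D = E"
  unfolding gderiv_def by (metis has_derivative_unique inner_commute vector_eq_rdot)

lemma grad_eq: "GDERIV f x :> D \<Longrightarrow> grad f x = D"
  unfolding grad_def by (blast intro: GDERIV_unique)

lemma GDERIV_norm_power2: "GDERIV (\<lambda>x. (norm (x - c))\<^sup>2 + b) x :> 2 *\<^sub>R (x - c)"
  unfolding gderiv_def power2_norm_eq_inner
  by (auto intro!: derivative_eq_intros simp: inner_commute)

lemma GDERIV_cong_open:
  assumes "open U" "x \<in> U" "\<And>z. z \<in> U \<Longrightarrow> f z = g z" "GDERIV g x :> D"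
  shows "GDERIV f x :> D"
  using assms unfolding gderiv_def
  by (metis has_derivative_transform_within_open)

text \<open>A piece inactive at \<open>y\<close> lies strictly above an active one at
  \<open>y\<close>, hence also nearby by continuity; finiteness of \<open>I\<close> makes the
  neighbourhood common to all inactive pieces.\<close>

lemma lower_envelope_eventually_active:
  assumes env: "lower_envelope I c \<beta> f" and fin: "finite I"
  shows "\<forall>\<^sub>F x in nhds y. \<exists>i\<in>active I c \<beta> f y. f x = (norm (x - c i))\<^sup>2 + \<beta> i"
proof -
  obtain j where j: "j \<in> I" "f y = (norm (y - c j))\<^sup>2 + \<beta> j"
    using env by (auto simp: lower_envelope_def)
  have "\<forall>\<^sub>F x in nhds y. (norm (x - c j))\<^sup>2 + \<beta> j < (norm (x - c i))\<^sup>2 + \<beta> i"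
    if "i \<in> I - active I c \<beta> f y" for i
  proof -
    have "(norm (y - c j))\<^sup>2 + \<beta> j < (norm (y - c i))\<^sup>2 + \<beta> i"
    proof -
      have "f y \<le> (norm (y - c i))\<^sup>2 + \<beta> i" "f y \<noteq> (norm (y - c i))\<^sup>2 + \<beta> i"
        using that env by (auto simp: lower_envelope_def active_def)
      then show ?thesis using j(2) by linarith
    qed
    moreover have "open {x. (norm (x - c j))\<^sup>2 + \<beta> j < (norm (x - c i))\<^sup>2 + \<beta> i}"
      by (intro open_Collect_less continuous_intros)
    ultimately show ?thesis
      by (auto simp: eventually_nhds)
  qed
  then have "\<forall>\<^sub>F x in nhds y. \<forall>i\<in>I - active I c \<beta> f y.
      (norm (x - c j))\<^sup>2 + \<beta> j < (norm (x - c i))\<^sup>2 + \<beta> i"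
    using fin by (intro eventually_ball_finite) auto
  then show ?thesis
  proof eventually_elim
    case (elim x)
    obtain i where i: "i \<in> I" "f x = (norm (x - c i))\<^sup>2 + \<beta> i"
      using env by (auto simp: lower_envelope_def)
    moreover have "f x \<le> (norm (x - c j))\<^sup>2 + \<beta> j"
      using env j by (auto simp: lower_envelope_def)
    moreover have "i \<in> active I c \<beta> f y"
    proof (rule ccontr)
      assume "i \<notin> active I c \<beta> f y"
      with i(1) elim have "(norm (x - c j))\<^sup>2 + \<beta> j < (norm (x - c i))\<^sup>2 + \<beta> i" by blast
      with calculation show False by linarith
    qed
    ultimately show ?case by blast
  qed
qed

text \<open>All pieces have the same curvature, so the gap between two of them is affine along a
  line, and the inner products of \<open>u\<close> with the centres decide which one is
  lower.\<close>

lemma norm_power2_diff_along: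
  fixes y u c e :: "'a::real_inner"
  shows "(norm (y + s *\<^sub>R u - c))\<^sup>2 - (norm (y + s *\<^sub>R u - e))\<^sup>2 =
    (norm (y - c))\<^sup>2 - (norm (y - e))\<^sup>2 - 2 * s * (u \<bullet> c - u \<bullet> e)"
  by (simp add: power2_norm_eq_inner inner_simps inner_commute algebra_simps)

text \<open>An extreme point \<open>e\<close> of the hull of the active centres is exposed by some direction \<open>u\<close>;
  along \<open>y + s u\<close> with small \<open>s > 0\<close> only the pieces centred at \<open>e\<close> remain active.\<close>

lemma extreme_centre_in_clarke:
  assumes env: "lower_envelope I c \<beta> f" and fin: "finite I"
    and e: "e extreme_point_of (convex hull (c ` active I c \<beta> f y))"
  shows "2 *\<^sub>R (y - e) \<in> clarke f y"
proof -
  let ?J = "active I c \<beta> f y" and ?P = "convex hull (c ` active I c \<beta> f y)"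
  have finJ: "finite ?J" using fin by (simp add: active_def)
  \<comment> \<open>An extreme point of a general convex set need not be exposed; in a polyhedron
    every proper face is.\<close>
  have "polyhedron ?P"
    by (intro polytope_imp_polyhedron) (use finJ in \<open>auto simp: polytope_def\<close>)
  moreover have "{e} face_of ?P" using e by (simp add: face_of_singleton)
  ultimately have "{e} exposed_face_of ?P" by (simp add: exposed_face_of_polyhedron)
  then obtain u b where ub: "?P \<subseteq> {x. u \<bullet> x \<le> b}" "{e} = ?P \<inter> {x. u \<bullet> x = b}"
    by (auto simp: exposed_face_of_def)
  have less: "u \<bullet> c j < u \<bullet> e" if "j \<in> ?J" "c j \<noteq> e" for j
  proof -
    have "c j \<in> ?P" using that by (intro hull_inc) auto
    then have "u \<bullet> c j \<le> b" "u \<bullet> c j \<noteq> b" "u \<bullet> e = b" using ub that(2) by blast+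
    then show ?thesis by simp
  qed
  obtain k where k: "k \<in> ?J" "c k = e"
    using extreme_point_of_convex_hull[OF e] by auto
  define W where "W = {x. \<exists>i\<in>?J. f x = (norm (x - c i))\<^sup>2 + \<beta> i}"
  define H where "H = (\<Inter>j\<in>{j\<in>?J. c j \<noteq> e}.
      {x. (norm (x - c k))\<^sup>2 + \<beta> k < (norm (x - c j))\<^sup>2 + \<beta> j})"
  obtain U where U: "open U" "y \<in> U" "U \<subseteq> W"
    using lower_envelope_eventually_active[OF env fin, of y]
    by (auto simp: eventually_nhds W_def)
  have "open H"
    unfolding H_def using finJ
    by (intro open_INT ballI open_Collect_less continuous_intros) auto
  have f_eq: "f x = (norm (x - e))\<^sup>2 + \<beta> k" if x: "x \<in> U \<inter> H" for x
  proof -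
    obtain i where i: "i \<in> ?J" "f x = (norm (x - c i))\<^sup>2 + \<beta> i"
      using subsetD[OF U(3), of x] x unfolding W_def by blast
    have "f x \<le> (norm (x - c k))\<^sup>2 + \<beta> k"
      using env k by (auto simp: lower_envelope_def active_def)
    with i x have "c i = e" by (force simp: H_def)
    \<comment> \<open>Several indices may share the centre \<open>e\<close>; being active at
      \<open>y\<close> forces their offsets to agree.\<close>
    moreover have "\<beta> i = \<beta> k"
      using i(1) k \<open>c i = e\<close> by (auto simp: active_def)
    ultimately show ?thesis using i by simp
  qed
  have grd: "GDERIV f x :> 2 *\<^sub>R (x - e)" if x: "x \<in> U \<inter> H" for x
    by (rule GDERIV_cong_open[OF _ x f_eq GDERIV_norm_power2])
       (use U(1) \<open>open H\<close> in auto)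
  define p where "p n = y + inverse (real (Suc n)) *\<^sub>R u" for n
  have p: "p \<longlonglongrightarrow> y"
    using tendsto_add[OF tendsto_const tendsto_scaleR[OF LIMSEQ_inverse_real_of_nat tendsto_const], of y u]
    by (simp add: p_def[abs_def])
  have pH: "p n \<in> H" for n
  proof -
    have "(norm (p n - c k))\<^sup>2 + \<beta> k < (norm (p n - c j))\<^sup>2 + \<beta> j"
      if "j \<in> ?J" "c j \<noteq> e" for j
    proof -
      define r where "r = inverse (real (Suc n))"
      have "0 < r * (u \<bullet> e - u \<bullet> c j)"
        using less[OF that] by (intro mult_pos_pos) (auto simp: r_def)
      moreover have "(norm (y - c j))\<^sup>2 + \<beta> j = (norm (y - e))\<^sup>2 + \<beta> k"
        using that k by (auto simp: active_def)
      ultimately show ?thesis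
        using norm_power2_diff_along[of y r u "c j" e] k(2)
        unfolding p_def r_def[symmetric] by (simp add: algebra_simps)
    qed
    then show ?thesis by (auto simp: H_def)
  qed
  obtain N where N: "\<And>n. n \<ge> N \<Longrightarrow> p n \<in> U"
    using topological_tendstoD[OF p U(1,2)] by (auto simp: eventually_sequentially)
  \<comment> \<open>\<open>clarke\<close> asks for differentiability at every term, so the terms
    before \<open>p\<close> enters \<open>U\<close> are dropped.\<close>
  define q where "q n = p (n + N)" for n
  have q: "q \<longlonglongrightarrow> y" unfolding q_def by (rule LIMSEQ_ignore_initial_segment[OF p])
  have gq: "GDERIV f (q n) :> 2 *\<^sub>R (q n - e)" for n
    using grd N pH by (simp add: q_def)
  have "(\<lambda>n. grad f (q n)) \<longlonglongrightarrow> 2 *\<^sub>R (y - e)"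
    unfolding grad_eq[OF gq] by (intro tendsto_intros q)
  moreover have "f differentiable (at (q n))" for n
    using gq by (auto simp: gderiv_def differentiable_def)
  ultimately show ?thesis
    unfolding clarke_def using q by (intro hull_inc) auto
qed

text \<open>By Krein-Milman the polytope is the hull of its extreme points,
  \<open>clarke f y\<close> is convex, and mapping z to 2(y - z) is affine. The detour is forced: a
  non-extreme active centre need not produce the gradient anywhere near \<open>y\<close>.\<close>

lemma convex_hull_centres_in_clarke:
  assumes "lower_envelope I c \<beta> f" "finite I" "m \<in> convex hull (c ` active I c \<beta> f y)"
  shows "2 *\<^sub>R (y - m) \<in> clarke f y"
proof -
  let ?P = "convex hull (c ` active I c \<beta> f y)" and ?h = "\<lambda>z. 2 *\<^sub>R y + (- 2) *\<^sub>R z"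
  have "finite (c ` active I c \<beta> f y)" using assms(2) by (simp add: active_def)
  then have P: "?P = convex hull {x. x extreme_point_of ?P}"
    by (intro Krein_Milman_Minkowski compact_convex_hull finite_imp_compact) auto
  have h: "?h z = 2 *\<^sub>R (y - z)" for z by (simp add: algebra_simps)
  have "?h ` ?P = convex hull (?h ` {x. x extreme_point_of ?P})"
    by (subst P) (rule convex_hull_affinity[symmetric])
  also have "\<dots> \<subseteq> clarke f y"
    using extreme_centre_in_clarke[OF assms(1,2)]
    by (intro hull_minimal) (auto simp: h simp del: scaleR_minus_left, auto simp: clarke_def)
  finally show ?thesis using assms(3) h by (metis image_subset_iff)
qed

text \<open>Moving from \<open>y\<close> straight towards \<open>c i\<close> strictly lowers piece
  \<open>i\<close>, which lies above \<open>f\<close> and touches it at \<open>y\<close>.\<close>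

lemma lower_envelope_local_min:
  assumes env: "lower_envelope I c \<beta> f" and i: "i \<in> active I c \<beta> f y"
    and min: "\<forall>\<^sub>F x in nhds y. f y \<le> f x"
  shows "c i = y"
proof (rule ccontr)
  assume ne: "c i \<noteq> y"
  let ?p = "\<lambda>s. y + s *\<^sub>R (c i - y)"
  have "(?p \<longlongrightarrow> y) (at_right 0)"
    by (auto intro!: tendsto_eq_intros)
  then have "\<forall>\<^sub>F s in at_right 0. f y \<le> f (?p s)"
    by (rule eventually_compose_filterlim[OF min])
  moreover have "\<forall>\<^sub>F s in at_right (0::real). s < 1"
    by (rule eventually_at_right_field[THEN iffD2]) (auto intro!: exI[of _ 1])
  ultimately have "\<forall>\<^sub>F s in at_right (0::real). False"
    using eventually_at_right_less[of 0]
  proof eventually_elim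
    case (elim s)
    have "f (?p s) \<le> (norm (?p s - c i))\<^sup>2 + \<beta> i"
      using env i by (auto simp: lower_envelope_def active_def)
    moreover have "f y = (norm (y - c i))\<^sup>2 + \<beta> i"
      using i by (simp add: active_def)
    ultimately have "norm (y - c i) ^ 2 \<le> norm (?p s - c i) ^ 2"
      using elim by linarith
    moreover have "?p s - c i = (1 - s) *\<^sub>R (y - c i)" by (simp add: algebra_simps)
    ultimately have "norm (y - c i) \<le> (1 - s) * norm (y - c i)"
      using elim by (simp add: power2_le_iff_abs_le)
    then show ?case using ne elim by (simp add: algebra_simps mult_le_0_iff)
  qed
  then show False by simp
qed

section \<open>Smoothness of quadratic functions\<close>

lemma Ck_on_cong:
  assumes "open U" "\<And>x. x \<in> U \<Longrightarrow> f x = g x"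
  shows "Ck_on k f U \<longleftrightarrow> Ck_on k g U"
  using assms(2)
proof (induction k arbitrary: f g)
  case 0
  then show ?case by (simp cong: continuous_on_cong)
next
  case (Suc k)
  have eq: "(f has_derivative D) (at x) \<longleftrightarrow> (g has_derivative D) (at x)" if "x \<in> U" for x D
    using has_derivative_transform_within_open[OF _ assms(1) that, of f D UNIV g]
      has_derivative_transform_within_open[OF _ assms(1) that, of g D UNIV f] Suc.prems
    by auto
  have "Ck_on k (\<lambda>x. frechet_derivative f (at x) v) U \<longleftrightarrow>
      Ck_on k (\<lambda>x. frechet_derivative g (at x) v) U" for v
    by (rule Suc.IH) (simp add: frechet_derivative_def eq)
  moreover have "f differentiable (at x) \<longleftrightarrow> g differentiable (at x)" if "x \<in> U" for x
    using eq[OF that] by (simp add: differentiable_def)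
  ultimately show ?case by simp
qed

text \<open>The family is closed under directional derivatives: in direction v the coefficients
  become 0, 2 \<alpha> v and the inner product of u and v. Hence the induction over arbitrary
  coefficients.\<close>

lemma Ck_on_quadratic: "Ck_on k (\<lambda>x. \<alpha> * (x \<bullet> x) + u \<bullet> x + \<beta>) U"
proof (induction k arbitrary: \<alpha> u \<beta>)
  case 0
  show ?case by (auto intro!: continuous_intros)
next
  case (Suc k)
  have D: "((\<lambda>x. \<alpha> * (x \<bullet> x) + u \<bullet> x + \<beta>) has_derivative (\<lambda>v. 0 * (x \<bullet> x) + (2 * \<alpha>) *\<^sub>R v \<bullet> x + u \<bullet> v)) (at x)" for x
    by (auto intro!: derivative_eq_intros simp: inner_commute algebra_simps)
  show ?case
    unfolding Ck_on.simps frechet_derivative_at[OF D, symmetric]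
    using Suc.IH D by (blast intro: differentiableI)
qed

lemma smooth_near_quadratic:
  assumes "\<forall>\<^sub>F x in nhds y. f x = (norm (x - c))\<^sup>2 + b"
  shows "smooth_near f y"
proof -
  obtain U where U: "open U" "y \<in> U" "\<And>x. x \<in> U \<Longrightarrow> f x = 1 * (x \<bullet> x) + (- 2 *\<^sub>R c) \<bullet> x + (c \<bullet> c + b)"
    using assms by (auto simp: eventually_nhds power2_norm_eq_inner inner_simps inner_commute algebra_simps)
  have "Ck_on k f U" for k
    using Ck_on_cong[OF U(1), of f _ k, THEN iffD2, OF U(3) Ck_on_quadratic] .
  then show ?thesis using U(1,2) by (auto simp: smooth_near_def)
qed

section \<open>Gibbs means of weighted atoms\<close>

lemma sqdist_lower_envelope:
  assumes "finite I" "I \<noteq> {}"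
  shows "lower_envelope I a (\<lambda>_. 0) (sqdist (a ` I))"
  unfolding lower_envelope_def
proof (intro allI conjI ballI)
  fix x i assume "i \<in> I"
  then have "infdist x (a ` I) \<le> norm (x - a i)"
    using infdist_le[of "a i" "a ` I" x] by (simp add: dist_norm)
  then show "sqdist (a ` I) x \<le> (norm (x - a i))\<^sup>2 + 0"
    by (simp add: sqdist_def infdist_nonneg power_mono)
next
  fix x
  have "closed (a ` I)" "a ` I \<noteq> {}" using assms by (auto intro: finite_imp_closed)
  then obtain z where "z \<in> a ` I" "infdist x (a ` I) = dist x z"
    by (rule infdist_attains_inf)
  then show "\<exists>i\<in>I. sqdist (a ` I) x = (norm (x - a i))\<^sup>2 + 0"
    by (auto simp: sqdist_def dist_norm)
qed

lemma exp_minus_le_inverse: "0 < u \<Longrightarrow> exp (- u) \<le> 1 / (u::real)"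
  using exp_ge_add_one_self[of u] by (simp add: exp_minus field_simps del: exp_ge_add_one_self)

lemma mult_exp_minus_le_1: "0 \<le> u \<Longrightarrow> u * exp (- u) \<le> (1::real)"
  using exp_minus_le_inverse[of u] by (cases "u = 0") (auto simp: field_simps)

locale weighted_atoms =
  fixes I :: "'i set" and w :: "'i \<Rightarrow> real" and a :: "'i \<Rightarrow> 'a::euclidean_space"
  assumes finite_I: "finite I" and w_pos: "i \<in> I \<Longrightarrow> 0 < w i" and sum_w: "sum w I = 1"
begin

text \<open>At s = 1 / (4 t) this is the weighted heat kernel of atom \<open>i\<close> without its
  normalising factor, which does not affect gradients of logarithms.\<close>

definition gibbs :: "real \<Rightarrow> 'a \<Rightarrow> 'i \<Rightarrow> real" where
  "gibbs s x i = w i * exp (- (s * (norm (x - a i))\<^sup>2))"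

definition Z :: "real \<Rightarrow> 'a \<Rightarrow> real" where
  "Z s x = (\<Sum>i\<in>I. gibbs s x i)"

definition mean :: "real \<Rightarrow> 'a \<Rightarrow> 'a" where
  "mean s x = (\<Sum>i\<in>I. (gibbs s x i / Z s x) *\<^sub>R a i)"

text \<open>Minus the relative entropy of the Gibbs distribution \<open>gibbs s x i / Z s x\<close>
  with respect to the weights \<open>w\<close>.\<close>

definition entropy_defect :: "real \<Rightarrow> 'a \<Rightarrow> real" where
  "entropy_defect s x = ln (Z s x) + s * (\<Sum>i\<in>I. gibbs s x i / Z s x * (norm (x - a i))\<^sup>2)"

definition nearest :: "'a \<Rightarrow> 'i set" where
  "nearest y = active I a (\<lambda>_. 0) (sqdist (a ` I)) y"

lemma I_nonempty: "I \<noteq> {}"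
  using sum_w by auto

lemma envelope: "lower_envelope I a (\<lambda>_. 0) (sqdist (a ` I))"
  by (rule sqdist_lower_envelope[OF finite_I I_nonempty])

lemma nearest_subset: "nearest y \<subseteq> I"
  by (auto simp: nearest_def active_def)

lemma nearest_nonempty: "nearest y \<noteq> {}"
  using envelope by (auto simp: nearest_def active_def lower_envelope_def)

lemma w_le_1: "i \<in> I \<Longrightarrow> w i \<le> 1"
  using member_le_sum[of i I w] finite_I w_pos sum_w by (auto intro: less_imp_le)

lemma gibbs_pos: "i \<in> I \<Longrightarrow> 0 < gibbs s x i"
  by (simp add: gibbs_def w_pos)

lemma gibbs_le_Z: "i \<in> I \<Longrightarrow> gibbs s x i \<le> Z s x"
  unfolding Z_def using finite_I gibbs_pos by (intro member_le_sum) (auto intro: less_imp_le)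

lemma Z_pos: "0 < Z s x"
  unfolding Z_def using finite_I I_nonempty gibbs_pos by (intro sum_pos) auto

lemma sum_gibbs_Z: "(\<Sum>i\<in>I. gibbs s x i / Z s x) = 1"
  using Z_pos[of s x] by (simp add: Z_def flip: sum_divide_distrib)

lemma mean_in_hull: "mean s x \<in> convex hull (a ` I)"
  unfolding mean_def using sum_gibbs_Z gibbs_pos Z_pos finite_I
  by (intro convex_sum) (auto intro!: hull_inc less_imp_le divide_nonneg_pos)

lemma GDERIV_ln_Z: "GDERIV (\<lambda>x. ln (Z s x)) x :> (- 2 * s) *\<^sub>R (x - mean s x)"
proof -
  have "((\<lambda>x. ln (Z s x)) has_derivative
      (\<lambda>h. (\<Sum>i\<in>I. gibbs s x i * (- (s * (2 * (h \<bullet> (x - a i)))))) / Z s x)) (at x)"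
    unfolding Z_def gibbs_def power2_norm_eq_inner
    using Z_pos[of s x]
    by (auto intro!: derivative_eq_intros sum.cong
        simp: Z_def gibbs_def power2_norm_eq_inner inner_commute divide_inverse algebra_simps
          sum_distrib_left)
  moreover have "(\<Sum>i\<in>I. gibbs s x i * (- (s * (2 * (h \<bullet> (x - a i)))))) / Z s x
      = h \<bullet> ((- 2 * s) *\<^sub>R (x - mean s x))" for h
  proof -
    have "(\<Sum>i\<in>I. gibbs s x i * (- (s * (2 * (h \<bullet> (x - a i)))))) / Z s x
      = (\<Sum>i\<in>I. (- 2 * s * (h \<bullet> x)) * (gibbs s x i / Z s x) + 2 * s * (gibbs s x i / Z s x * (h \<bullet> a i)))"
      unfolding sum_divide_distrib
      by (intro sum.cong) (simp_all add: inner_diff_right algebra_simps diff_divide_distrib add_divide_distrib)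
    also have "\<dots> = (- 2 * s * (h \<bullet> x)) * (\<Sum>i\<in>I. gibbs s x i / Z s x) + 2 * s * (h \<bullet> mean s x)"
      by (simp only: sum.distrib sum_distrib_left[symmetric] mean_def inner_sum_right inner_scaleR_right)
    finally show ?thesis by (simp add: sum_gibbs_Z inner_diff_right algebra_simps)
  qed
  ultimately show ?thesis by (simp add: gderiv_def)
qed

text \<open>Relative to a nearest atom \<open>j\<close>, any other atom \<open>i\<close> has weight
  at most exp (- s \<delta> i) / w j. Weakening this to 1 / (w j * s * \<delta> i) keeps the
  constant explicit and suffices, since 1 / s will be a multiple of exp (- \<tau>). The
  neighbourhood and \<open>K\<close> do not depend on s.\<close>

lemma mean_near_nearest_hull:
  "\<exists>K\<ge>0. \<forall>\<^sub>F x in nhds y. \<forall>s>0. \<exists>m\<in>convex hull (a ` nearest y). norm (mean s x - m) \<le> K / s"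
proof -
  let ?N = "nearest y" and ?q = "\<lambda>i x. (norm (x - a i))\<^sup>2"
  obtain j where j: "j \<in> ?N" using nearest_nonempty by auto
  then have jI: "j \<in> I" and qj: "?q j y = sqdist (a ` I) y"
    by (auto simp: nearest_def active_def)
  have finN: "finite ?N" using nearest_subset finite_I by (rule finite_subset)
  define R where "R = (\<Sum>i\<in>I. norm (a i))"
  have R: "norm (a i) \<le> R" if "i \<in> I" for i
    unfolding R_def using that finite_I by (intro member_le_sum) auto
  have hullR: "convex hull (a ` ?N) \<subseteq> cball 0 R"
    using R nearest_subset by (intro hull_minimal) (auto simp: subset_eq)
  \<comment> \<open>Half the gap at \<open>y\<close>, so that the gap still exceeds
    \<open>\<delta> i\<close> throughout a neighbourhood.\<close>
  define \<delta> where "\<delta> i = (?q i y - ?q j y) / 2" for i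
  have \<delta>: "0 < \<delta> i" if "i \<in> I - ?N" for i
  proof -
    have "sqdist (a ` I) y \<le> ?q i y" "sqdist (a ` I) y \<noteq> ?q i y"
      using that envelope by (auto simp: nearest_def active_def lower_envelope_def)
    then show ?thesis by (simp add: \<delta>_def qj)
  qed
  define K where "K = (\<Sum>i\<in>I - ?N. 2 * R / (w j * \<delta> i))"
  have "0 \<le> R" unfolding R_def by (intro sum_nonneg) auto
  then have "0 \<le> K" unfolding K_def using \<delta> w_pos[OF jI]
    by (intro sum_nonneg divide_nonneg_pos mult_pos_pos) auto
  have "\<forall>\<^sub>F x in nhds y. \<delta> i < ?q i x - ?q j x" if "i \<in> I - ?N" for i
  proof -
    have "open {x. \<delta> i < ?q i x - ?q j x}"
      by (intro open_Collect_less continuous_intros)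
    moreover have "\<delta> i < ?q i y - ?q j y" using \<delta>[OF that] by (simp add: \<delta>_def)
    ultimately show ?thesis by (auto simp: eventually_nhds)
  qed
  then have "\<forall>\<^sub>F x in nhds y. \<forall>i\<in>I - ?N. \<delta> i < ?q i x - ?q j x"
    using finite_I by (intro eventually_ball_finite) auto
  then have "\<forall>\<^sub>F x in nhds y. \<forall>s>0. \<exists>m\<in>convex hull (a ` ?N). norm (mean s x - m) \<le> K / s"
  proof eventually_elim
    case (elim x)
    show ?case
    proof (intro allI impI)
      fix s :: real assume s: "0 < s"
      let ?g = "\<lambda>i. gibbs s x i"
      define ZN where "ZN = (\<Sum>i\<in>?N. ?g i)"
      have ZN: "0 < ZN" unfolding ZN_def
        using finN nearest_nonempty gibbs_pos subsetD[OF nearest_subset] by (intro sum_pos) auto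
      \<comment> \<open>The Gibbs distribution conditioned on the nearest atoms; their contributions
        to \<open>mean s x - m\<close> then cancel.\<close>
      define m where "m = (\<Sum>i\<in>?N. (?g i / ZN) *\<^sub>R a i)"
      have gnn: "0 \<le> ?g i" if "i \<in> I" for i using gibbs_pos[OF that] by (rule less_imp_le)
      have m: "m \<in> convex hull (a ` ?N)"
        unfolding m_def using ZN nearest_subset gnn finN
        by (intro convex_sum) (auto intro!: hull_inc divide_nonneg_pos simp: ZN_def simp flip: sum_divide_distrib)
      have nm: "norm m \<le> R" using m hullR by auto
      have Zm: "ZN *\<^sub>R m = (\<Sum>i\<in>?N. ?g i *\<^sub>R a i)"
        using ZN by (simp add: m_def scaleR_sum_right)
      have splitI: "sum f I = sum f ?N + sum f (I - ?N)" for f :: "'i \<Rightarrow> 'b::comm_monoid_add"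
        using sum.subset_diff[OF nearest_subset finite_I, of f y] by (simp add: add.commute)
      have "Z s x *\<^sub>R mean s x = (\<Sum>i\<in>I. ?g i *\<^sub>R a i)"
        using Z_pos[of s x] by (simp add: mean_def scaleR_sum_right)
      also have "\<dots> = ZN *\<^sub>R m + (\<Sum>i\<in>I - ?N. ?g i *\<^sub>R a i)"
        by (simp add: splitI Zm)
      finally have "Z s x *\<^sub>R (mean s x - m) = (\<Sum>i\<in>I - ?N. ?g i *\<^sub>R (a i - m))"
        by (simp add: scaleR_diff_right sum_subtractf Z_def splitI[of ?g] ZN_def scaleR_left_distrib
            flip: scaleR_sum_left)
      then have "mean s x - m = (\<Sum>i\<in>I - ?N. (?g i / Z s x) *\<^sub>R (a i - m))"
        using Z_pos[of s x]
        by (simp add: divide_inverse_commute flip: scaleR_scaleR scaleR_sum_right)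
           (metis scaleR_one scaleR_scaleR left_inverse less_irrefl)
      also have "norm \<dots> \<le> (\<Sum>i\<in>I - ?N. (2 * R / (w j * \<delta> i)) / s)"
      proof (rule sum_norm_le)
        fix i assume i: "i \<in> I - ?N"
        have "?g i / Z s x \<le> ?g i / ?g j"
          using i gnn gibbs_pos[OF jI, of s x] gibbs_le_Z[OF jI, of s x] by (intro divide_left_mono) (auto intro: mult_pos_pos Z_pos)
        also have "\<dots> = w i / w j * exp (- (s * (?q i x - ?q j x)))"
          by (simp add: gibbs_def exp_diff exp_minus field_simps right_diff_distrib)
        also have "\<dots> \<le> 1 / w j * exp (- (s * \<delta> i))"
          using i elim s w_le_1[of i] w_pos[OF jI] w_pos[of i] 
          by (intro mult_mono divide_right_mono) (auto intro: less_imp_le)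
        also have "\<dots> \<le> 1 / w j * (1 / (s * \<delta> i))"
          using exp_minus_le_inverse[of "s * \<delta> i"] s \<delta>[OF i] w_pos[OF jI]
          by (intro mult_left_mono) auto
        finally have g: "?g i / Z s x \<le> 1 / (w j * \<delta> i * s)" by (simp add: mult_ac)
        have "norm (a i - m) \<le> 2 * R"
          using norm_triangle_ineq4[of "a i" m] R[of i] nm i by auto
        with g have "?g i / Z s x * norm (a i - m) \<le> 1 / (w j * \<delta> i * s) * (2 * R)"
          using gnn[of i] Z_pos[of s x] i w_pos[OF jI] \<delta>[OF i] s by (intro mult_mono) auto
        then show "norm ((?g i / Z s x) *\<^sub>R (a i - m)) \<le> (2 * R / (w j * \<delta> i)) / s"
          using gnn[of i] Z_pos[of s x] i by (simp add: abs_of_pos abs_of_nonneg)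
      qed
      also have "\<dots> = K / s" by (simp add: K_def sum_divide_distrib)
      finally show "\<exists>m\<in>convex hull (a ` ?N). norm (mean s x - m) \<le> K / s" using m by auto
    qed
  qed
  then show ?thesis using \<open>0 \<le> K\<close> by blast
qed

text \<open>Subtracting the smallest squared distance from all of them cancels between
  \<open>ln (Z s x)\<close> and the averaged energy. The exponents \<open>?r i\<close> are then
  nonnegative, the normalised sum \<open>Z'\<close> lies between the least weight and 1, and r exp
  (- r) is at most 1.\<close>

lemma entropy_defect_bounded: "\<exists>B. \<forall>s>0. \<forall>x. \<bar>entropy_defect s x\<bar> \<le> B"
proof -
  define \<mu> where "\<mu> = Min (w ` I)"
  have \<mu>: "0 < \<mu>" "\<And>i. i \<in> I \<Longrightarrow> \<mu> \<le> w i"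
    unfolding \<mu>_def using finite_I I_nonempty w_pos by auto
  have "\<bar>entropy_defect s x\<bar> \<le> - ln \<mu> + 1 / \<mu>" if s: "0 < s" for s x
  proof -
    let ?q = "\<lambda>i. (norm (x - a i))\<^sup>2"
    obtain j where j: "j \<in> I" "\<And>i. i \<in> I \<Longrightarrow> ?q j \<le> ?q i"
      using envelope unfolding lower_envelope_def by (metis add.right_neutral)
    let ?r = "\<lambda>i. s * (?q i - ?q j)"
    have r: "0 \<le> ?r i" if "i \<in> I" for i using j that s by simp
    define Z' where "Z' = (\<Sum>i\<in>I. w i * exp (- ?r i))"
    have g: "gibbs s x i = exp (- (s * ?q j)) * (w i * exp (- ?r i))" for i
      by (simp add: gibbs_def right_diff_distrib exp_diff exp_minus field_simps)
    have ZZ': "Z s x = exp (- (s * ?q j)) * Z'"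
      by (simp add: Z_def Z'_def g sum_distrib_left)
    have "w j * exp (- ?r j) \<le> Z'"
      unfolding Z'_def using finite_I j w_pos by (intro member_le_sum) (auto intro: less_imp_le)
    then have Z'1: "\<mu> \<le> Z'" using \<mu>(2)[OF j(1)] by simp
    have e: "exp (- ?r i) \<le> 1" if "i \<in> I" for i
      using r[OF that] unfolding exp_le_one_iff by linarith
    have "Z' \<le> (\<Sum>i\<in>I. w i * 1)"
      unfolding Z'_def by (intro sum_mono mult_left_mono e less_imp_le[OF w_pos])
    then have Z'2: "Z' \<le> 1" by (simp add: sum_w)
    have Z'0: "0 < Z'" using Z'1 \<mu> by linarith
    have gZ: "gibbs s x i / Z s x = w i * exp (- ?r i) / Z'" for i
      by (simp add: g ZZ')
    have "s * (\<Sum>i\<in>I. gibbs s x i / Z s x * ?q i)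
        = (\<Sum>i\<in>I. s * ?q j * (gibbs s x i / Z s x) + gibbs s x i / Z s x * ?r i)"
      by (simp add: sum_distrib_left algebra_simps)
    also have "\<dots> = s * ?q j + (\<Sum>i\<in>I. gibbs s x i / Z s x * ?r i)"
      by (simp only: sum.distrib sum_distrib_left[symmetric] sum_gibbs_Z mult_1_right)
    also have "(\<Sum>i\<in>I. gibbs s x i / Z s x * ?r i) = (\<Sum>i\<in>I. w i * (?r i * exp (- ?r i))) / Z'"
      unfolding gZ sum_divide_distrib by (intro sum.cong) auto
    finally have eq: "entropy_defect s x = ln Z' + (\<Sum>i\<in>I. w i * (?r i * exp (- ?r i))) / Z'"
      using Z'0 by (simp add: entropy_defect_def ZZ' ln_mult)
    have "(\<Sum>i\<in>I. w i * (?r i * exp (- ?r i))) \<le> (\<Sum>i\<in>I. w i * 1)"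
      using w_pos mult_exp_minus_le_1[OF r] by (intro sum_mono mult_left_mono) (auto intro: less_imp_le)
    moreover have "0 \<le> (\<Sum>i\<in>I. w i * (?r i * exp (- ?r i)))"
    proof (rule sum_nonneg)
      fix i assume "i \<in> I"
      then show "0 \<le> w i * (?r i * exp (- ?r i))"
        using w_pos r by (metis exp_ge_zero less_imp_le mult_nonneg_nonneg)
    qed
    ultimately have "0 \<le> (\<Sum>i\<in>I. w i * (?r i * exp (- ?r i))) / Z'"
        "(\<Sum>i\<in>I. w i * (?r i * exp (- ?r i))) / Z' \<le> 1 / \<mu>"
      using Z'1 \<mu>(1) by (auto intro!: frac_le simp: sum_w)
    moreover have "ln \<mu> \<le> ln Z'" "ln Z' \<le> 0" using Z'1 Z'2 Z'0 \<mu>(1) by auto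
    moreover have "0 < 1 / \<mu>" using \<mu>(1) by simp
    ultimately show ?thesis unfolding eq by linarith
  qed
  then show ?thesis by blast
qed

text \<open>The lower bound uses total weight 1, the upper one keeps a single atom in
  \<open>Z\<close>. The energy estimate uses both because 1 - \<lambda> may be negative.\<close>

lemma potential_bounds:
  assumes "0 < s" "i \<in> I"
  shows "0 \<le> - ln (Z s x) / s" "- ln (Z s x) / s \<le> (norm (x - a i))\<^sup>2 + (- ln (w i)) / s"
proof -
  have "Z s x \<le> (\<Sum>i\<in>I. w i * 1)"
    unfolding Z_def gibbs_def using w_pos assms(1)
    by (intro sum_mono mult_left_mono) (auto intro: less_imp_le)
  then have "ln (Z s x) \<le> 0" using Z_pos by (simp add: sum_w)
  then show "0 \<le> - ln (Z s x) / s" using assms(1) by (simp add: divide_nonpos_pos)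
  have "ln (gibbs s x i) \<le> ln (Z s x)"
    using gibbs_le_Z gibbs_pos Z_pos assms(2) by auto
  then have "- ln (Z s x) \<le> s * (norm (x - a i))\<^sup>2 - ln (w i)"
    using w_pos[OF assms(2)] by (simp add: gibbs_def ln_mult)
  then have "- ln (Z s x) / s \<le> (s * (norm (x - a i))\<^sup>2 - ln (w i)) / s"
    using assms(1) by (intro divide_right_mono) auto
  then show "- ln (Z s x) / s \<le> (norm (x - a i))\<^sup>2 + (- ln (w i)) / s"
    using assms(1) by (simp add: field_simps)
qed

text \<open>The motion of \<open>Y\<close> enters through the spatial gradient 2 (x - mean). The
  explicit dependence on s contributes entropy defect / s^2, multiplied by ds/d\<tau> = s.\<close>

lemma potential_has_derivative:
  assumes Y: "(Y has_vector_derivative Y') (at \<tau> within D)" and "0 < \<kappa>"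
  defines "s \<equiv> \<kappa> * exp \<tau>"
  shows "((\<lambda>\<sigma>. - ln (Z (\<kappa> * exp \<sigma>) (Y \<sigma>)) / (\<kappa> * exp \<sigma>)) has_real_derivative
      2 * ((Y \<tau> - mean s (Y \<tau>)) \<bullet> Y') + entropy_defect s (Y \<tau>) / s) (at \<tau> within D)"
proof -
  have s: "0 < s" using assms by simp
  let ?q = "\<lambda>i. (norm (Y \<tau> - a i))\<^sup>2" and ?q' = "\<lambda>i. 2 * ((Y \<tau> - a i) \<bullet> Y')"
  let ?p = "\<lambda>i. gibbs s (Y \<tau>) i / Z s (Y \<tau>)"
  have q: "((\<lambda>\<sigma>. (norm (Y \<sigma> - a i))\<^sup>2) has_real_derivative ?q' i) (at \<tau> within D)" for i
    using Y unfolding power2_norm_eq_inner has_field_derivative_def has_vector_derivative_def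
    by (auto intro!: derivative_eq_intros simp: inner_commute algebra_simps)
  have sd: "((\<lambda>\<sigma>. \<kappa> * exp \<sigma>) has_real_derivative s) (at \<tau> within D)"
    unfolding s_def by (auto intro!: derivative_eq_intros)
  have g: "((\<lambda>\<sigma>. gibbs (\<kappa> * exp \<sigma>) (Y \<sigma>) i) has_real_derivative
      gibbs s (Y \<tau>) i * (- (s * (?q i + ?q' i)))) (at \<tau> within D)" for i
    unfolding gibbs_def
    by (rule derivative_eq_intros sd q refl)+ (simp add: s_def algebra_simps)
  have Zd: "((\<lambda>\<sigma>. Z (\<kappa> * exp \<sigma>) (Y \<sigma>)) has_real_derivative
      (\<Sum>i\<in>I. gibbs s (Y \<tau>) i * (- (s * (?q i + ?q' i))))) (at \<tau> within D)"
    unfolding Z_def by (intro DERIV_sum g)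
  have D: "((\<lambda>\<sigma>. - ln (Z (\<kappa> * exp \<sigma>) (Y \<sigma>)) / (\<kappa> * exp \<sigma>)) has_real_derivative
      - ((\<Sum>i\<in>I. gibbs s (Y \<tau>) i * (- (s * (?q i + ?q' i)))) / Z s (Y \<tau>)) / s
        + ln (Z s (Y \<tau>)) / s) (at \<tau> within D)"
  proof (rule DERIV_cong[OF DERIV_divide[OF DERIV_minus[OF DERIV_chain2[OF DERIV_ln_divide Zd]] sd]])
    show "0 < Z (\<kappa> * exp \<tau>) (Y \<tau>)" by (rule Z_pos)
    have "(- (1 / z * N) * s - (- L) * s) / (s * s) = - (N / z) / s + L / s" for N z L :: real
      using s by (simp add: divide_inverse algebra_simps)
    then show "(- (1 / Z (\<kappa> * exp \<tau>) (Y \<tau>) *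
        (\<Sum>i\<in>I. gibbs s (Y \<tau>) i * (- (s * (?q i + ?q' i))))) * (\<kappa> * exp \<tau>) -
        (- ln (Z (\<kappa> * exp \<tau>) (Y \<tau>))) * s) / ((\<kappa> * exp \<tau>) * (\<kappa> * exp \<tau>)) =
      - ((\<Sum>i\<in>I. gibbs s (Y \<tau>) i * (- (s * (?q i + ?q' i)))) / Z s (Y \<tau>)) / s
        + ln (Z s (Y \<tau>)) / s"
      unfolding s_def[symmetric] .
  qed (use s in \<open>simp add: s_def[symmetric]\<close>)
  have A: "- ((\<Sum>i\<in>I. gibbs s (Y \<tau>) i * (- (s * (?q i + ?q' i)))) / Z s (Y \<tau>)) / s
      = (\<Sum>i\<in>I. ?p i * ?q i) + (\<Sum>i\<in>I. ?p i * ?q' i)"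
    unfolding sum_divide_distrib sum_negf[symmetric] sum.distrib[symmetric]
    using s Z_pos[of s "Y \<tau>"] by (intro sum.cong refl) (simp add: field_simps)
  have M: "(\<Sum>i\<in>I. ?p i * ?q' i) = 2 * ((Y \<tau> - mean s (Y \<tau>)) \<bullet> Y')"
  proof -
    have "(\<Sum>i\<in>I. ?p i * ?q' i) = (\<Sum>i\<in>I. (2 * (Y \<tau> \<bullet> Y')) * ?p i - 2 * (?p i * (a i \<bullet> Y')))"
      by (simp add: inner_diff_left algebra_simps)
    also have "\<dots> = 2 * (Y \<tau> \<bullet> Y') - 2 * (mean s (Y \<tau>) \<bullet> Y')"
      by (simp only: sum_subtractf sum_distrib_left[symmetric] sum_gibbs_Z mean_def inner_sum_left inner_scaleR_left mult_1_right)
    finally show ?thesis by (simp add: inner_diff_left)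
  qed
  show ?thesis
    by (rule DERIV_cong[OF D]) (simp only: A M entropy_defect_def, use s in \<open>simp add: add_divide_distrib\<close>)
qed

end

section \<open>Relaxation and limit sets\<close>

text \<open>\<open>\<mu>\<close> is the image under \<open>a\<close> of a point measure on the
  indices, which turns the heat integral into a finite sum; coinciding atoms simply keep separate
  indices.\<close>

lemma finite_dirac_mixture_atoms:
  fixes \<mu> :: "'a::euclidean_space measure"
  assumes "finite_dirac_mixture \<mu>"
  obtains I :: "nat set" and w a where "weighted_atoms I w" "supp \<mu> = a ` I"
    "\<And>x t. heat_flow \<mu> x t = (\<Sum>i\<in>I. w i * heat_kernel t (x - a i))"
  using assms unfolding finite_dirac_mixture_def
proof (elim conjE exE)
  fix n :: nat and a :: "nat \<Rightarrow> 'a" and w :: "nat \<Rightarrow> real"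
  assume sets: "sets \<mu> = sets borel" and w: "\<forall>k<n. 0 < w k" "(\<Sum>k<n. w k) = 1"
    and mu: "\<forall>B\<in>sets borel. emeasure \<mu> B =
      (\<Sum>k<n. ennreal (w k) * emeasure (return borel (a k)) B)"
  let ?M = "point_measure {..<n} w"
  have \<mu>: "\<mu> = distr ?M borel a"
  proof (rule measure_eqI)
    fix B assume B: "B \<in> sets \<mu>"
    have "emeasure (distr ?M borel a) B = emeasure ?M (a -` B \<inter> {..<n})"
      using B sets by (subst emeasure_distr) (auto simp: space_point_measure)
    also have "\<dots> = (\<Sum>k\<in>a -` B \<inter> {..<n}. ennreal (w k))"
      by (rule emeasure_point_measure_finite) auto
    also have "\<dots> = (\<Sum>k<n. ennreal (w k) * indicator B (a k))"
      by (rule sum.mono_neutral_cong_left) (auto simp: indicator_def)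
    also have "\<dots> = emeasure \<mu> B"
      using mu B sets by simp
    finally show "emeasure \<mu> B = emeasure (distr ?M borel a) B" ..
  qed (simp add: sets)
  have hf: "heat_flow \<mu> x t = (\<Sum>i<n. w i * heat_kernel t (x - a i))" for x t
  proof -
    have "(\<lambda>y. heat_kernel t (x - y)) \<in> borel_measurable borel"
      unfolding heat_kernel_def by measurable
    then have "heat_flow \<mu> x t = (\<integral>k. heat_kernel t (x - a k) \<partial>?M)"
      unfolding heat_flow_def \<mu> by (intro integral_distr) (auto simp: space_point_measure)
    also have "\<dots> = (\<Sum>i<n. w i *\<^sub>R heat_kernel t (x - a i))"
      using w by (intro lebesgue_integral_point_measure_finite) (auto intro: less_imp_le)
    finally show ?thesis by simp
  qed
  have sp: "supp \<mu> = a ` {..<n}"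
    using w mu by (intro supp_finite_dirac_mixture) auto
  have wa: "weighted_atoms {..<n} w"
    using w by unfold_locales auto
  show thesis by (rule that[OF wa sp hf])
qed

lemma GDERIV_ln_heat_flow:
  fixes \<mu> :: "'a::euclidean_space measure"
  assumes "weighted_atoms I w" "0 < t"
    and "\<And>x t. heat_flow \<mu> x t = (\<Sum>i\<in>I. w i * heat_kernel t (x - a i))"
  shows "GDERIV (\<lambda>x. ln (heat_flow \<mu> x t)) x :>
    (- 1 / (2 * t)) *\<^sub>R (x - weighted_atoms.mean I w a (1 / (4 * t)) x)"
proof -
  interpret weighted_atoms I w a by (rule assms)
  define C where "C = (4 * pi * t) powr (- real DIM('a) / 2)"
  then have C: "0 < C" using assms(2) by simp
  have "heat_flow \<mu> x t = C * Z (1 / (4 * t)) x" for x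
    unfolding assms(3) Z_def gibbs_def heat_kernel_def sum_distrib_left C_def
    by (intro sum.cong) auto
  then have "ln (heat_flow \<mu> x t) = ln C + ln (Z (1 / (4 * t)) x)" for x
    using C Z_pos[of "1 / (4 * t)" x] by (simp add: ln_mult)
  then have "(\<lambda>x. ln (heat_flow \<mu> x t)) = (\<lambda>x. ln C + ln (Z (1 / (4 * t)) x))" by auto
  moreover have "GDERIV (\<lambda>x. ln C + ln (Z (1 / (4 * t)) x)) x :>
      0 + (- 2 * (1 / (4 * t))) *\<^sub>R (x - mean (1 / (4 * t)) x)"
    by (intro GDERIV_add GDERIV_const GDERIV_ln_Z)
  ultimately show ?thesis by simp
qed

text \<open>The factor exp (\<tau> / 2) removes the linear term, leaving derivative (exp (\<tau> /
  2) / 2) (c - y), whose norm is dominated by the derivative of the scalar function on the right. At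
  p = 1/2 forcing and decay resonate. The cases used are p = 0 (boundedness) and p = 1
  (rate).\<close>

lemma relaxation_bound:
  fixes Y c :: "real \<Rightarrow> 'a::real_inner"
  assumes ode: "\<And>\<tau>. 0 \<le> \<tau> \<Longrightarrow> (Y has_vector_derivative (- 1/2) *\<^sub>R (Y \<tau> - c \<tau>)) (at \<tau> within {0..})"
    and "0 \<le> \<alpha>" "\<alpha> \<le> \<beta>" "p \<noteq> 1/2"
    and c: "\<And>\<tau>. \<alpha> \<le> \<tau> \<Longrightarrow> norm (c \<tau> - y) \<le> K * exp (- p * \<tau>)"
  shows "norm (exp (\<beta> / 2) *\<^sub>R (Y \<beta> - y) - exp (\<alpha> / 2) *\<^sub>R (Y \<alpha> - y))
    \<le> K / (1 - 2 * p) * (exp ((1/2 - p) * \<beta>) - exp ((1/2 - p) * \<alpha>))"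
proof (cases "\<alpha> = \<beta>")
  case False
  let ?f = "\<lambda>\<tau>. exp (\<tau> / 2) *\<^sub>R (Y \<tau> - y)" and ?\<phi> = "\<lambda>\<tau>. K / (1 - 2 * p) * exp ((1/2 - p) * \<tau>)"
  have "continuous_on {0..} Y"
    using ode by (auto simp: continuous_on_eq_continuous_within intro: has_vector_derivative_continuous)
  then have Y: "continuous_on {\<alpha>..\<beta>} Y"
    by (rule continuous_on_subset) (use assms in auto)
  have "norm (?f \<beta> - ?f \<alpha>) \<le> ?\<phi> \<beta> - ?\<phi> \<alpha>"
  proof (rule differentiable_bound_general)
    show "\<alpha> < \<beta>" using False assms by simp
    show "continuous_on {\<alpha>..\<beta>} ?f" "continuous_on {\<alpha>..\<beta>} ?\<phi>"
      using assms(4) by (auto intro!: continuous_intros Y)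
  next
    fix \<tau> assume \<tau>: "\<alpha> < \<tau>" "\<tau> < \<beta>"
    have Yd: "(Y has_vector_derivative (- 1/2) *\<^sub>R (Y \<tau> - c \<tau>)) (at \<tau>)"
    proof -
      have "at \<tau> within {0..} = at \<tau>"
        using \<tau> assms(2) by (intro at_within_interior) auto
      moreover have "(Y has_vector_derivative (- 1/2) *\<^sub>R (Y \<tau> - c \<tau>)) (at \<tau> within {0..})"
        by (rule ode) (use \<tau> assms(2) in auto)
      ultimately show ?thesis by metis
    qed
    show "(?f has_vector_derivative (exp (\<tau> / 2) / 2) *\<^sub>R (c \<tau> - y)) (at \<tau>)"
    proof (rule has_vector_derivative_eq_rhs)
      show "(?f has_vector_derivative exp (\<tau> / 2) *\<^sub>R ((- 1/2) *\<^sub>R (Y \<tau> - c \<tau>) - 0)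
          + (exp (\<tau> / 2) * (1 / 2)) *\<^sub>R (Y \<tau> - y)) (at \<tau>)"
        by (intro has_vector_derivative_scaleR has_vector_derivative_diff Yd has_vector_derivative_const)
           (auto intro!: derivative_eq_intros)
    qed (simp add: algebra_simps flip: scaleR_add_left)
    have "K / q * (q / 2) = K / 2" if "q \<noteq> 0" for q :: real
      using that by simp
    then have "K / (1 - 2 * p) * ((1 - 2 * p) / 2) = K / 2" using assms(4) by simp
    moreover have "(1 - 2 * p) / 2 = 1/2 - p" by (simp add: diff_divide_distrib)
    ultimately have K2: "K / (1 - 2 * p) * (1/2 - p) = K / 2" by (simp only:)
    have "(?\<phi> has_real_derivative K / (1 - 2 * p) * (1/2 - p) * exp ((1/2 - p) * \<tau>)) (at \<tau>)"
    proof (rule DERIV_cong)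
      show "(?\<phi> has_real_derivative K / (1 - 2 * p) * (exp ((1/2 - p) * \<tau>) * (1/2 - p))) (at \<tau>)"
        by (intro DERIV_cmult DERIV_fun_exp) (auto intro!: derivative_eq_intros)
    qed simp
    then show "(?\<phi> has_vector_derivative K / 2 * exp ((1/2 - p) * \<tau>)) (at \<tau>)"
      unfolding K2 has_real_derivative_iff_has_vector_derivative .
    have "norm ((exp (\<tau> / 2) / 2) *\<^sub>R (c \<tau> - y)) \<le> exp (\<tau> / 2) / 2 * (K * exp (- p * \<tau>))"
      using c[of \<tau>] \<tau> by simp
    also have "\<dots> = K / 2 * (exp (\<tau> / 2) * exp (- p * \<tau>))" by simp
    also have "exp (\<tau> / 2) * exp (- p * \<tau>) = exp ((1/2 - p) * \<tau>)"
      by (simp add: algebra_simps flip: exp_add)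
    finally show "norm ((exp (\<tau> / 2) / 2) *\<^sub>R (c \<tau> - y)) \<le> K / 2 * exp ((1/2 - p) * \<tau>)" .
  qed
  then show ?thesis by (simp add: right_diff_distrib)
qed simp

section \<open>Limit sets of bounded curves\<close>

lemma eventually_at_top_nonneg:
  fixes P :: "real \<Rightarrow> bool"
  assumes "\<forall>\<^sub>F \<tau> in at_top. P \<tau>"
  obtains T where "0 \<le> T" "\<And>\<tau>. T \<le> \<tau> \<Longrightarrow> P \<tau>"
proof -
  obtain T where "\<And>\<tau>. T \<le> \<tau> \<Longrightarrow> P \<tau>"
    using assms by (auto simp: eventually_at_top_linorder)
  then show ?thesis using that[of "max 0 T"] by simp
qed

text \<open>Otherwise Bolzano-Weierstrass, applied at arbitrarily late times outside
  \<open>U\<close>, gives a limit point in the closed complement.\<close>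

lemma omega_limit_open_eventually:
  fixes Y :: "real \<Rightarrow> 'a::euclidean_space"
  assumes bdd: "bounded (Y ` {0..})" and U: "open U" "omega_limit Y \<subseteq> U"
  shows "\<forall>\<^sub>F \<tau> in at_top. Y \<tau> \<in> U"
proof (rule ccontr)
  assume "\<not> ?thesis"
  then have "\<exists>\<tau>\<ge>real n. Y \<tau> \<notin> U" for n
    by (auto simp: eventually_at_top_linorder)
  then obtain \<sigma> where \<sigma>: "\<And>n. real n \<le> \<sigma> n" "\<And>n. Y (\<sigma> n) \<notin> U" by metis
  have "0 \<le> \<sigma> n" for n using \<sigma>(1)[of n] by linarith
  then have "bounded (range (\<lambda>n. Y (\<sigma> n)))"
    using bdd by (rule_tac bounded_subset) auto
  then obtain l r where r: "strict_mono (r :: nat \<Rightarrow> nat)" "((\<lambda>n. Y (\<sigma> n)) \<circ> r) \<longlonglongrightarrow> l"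
    using bounded_imp_convergent_subsequence by blast
  have "filterlim (\<lambda>n. real (r n)) at_top sequentially"
    using r(1) by (intro filterlim_compose[OF filterlim_real_sequentially] filterlim_subseq)
  then have "filterlim (\<lambda>n. \<sigma> (r n)) at_top sequentially"
    by (rule filterlim_at_top_mono) (use \<sigma> in auto)
  then have "l \<in> omega_limit Y"
    using r(2) by (auto simp: omega_limit_def o_def intro!: exI[of _ "\<lambda>n. \<sigma> (r n)"])
  moreover have "l \<in> - U"
    by (rule closed_sequentially[of "- U" "(\<lambda>n. Y (\<sigma> n)) \<circ> r"]) (use U \<sigma> r in auto)
  ultimately show False using U by auto
qed

text \<open>A limit point is isolated from the others, and a connected tail of the curve cannot keep
  passing between its small ball and the rest.\<close>

lemma omega_limit_finite_imp_tendsto: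
  fixes Y :: "real \<Rightarrow> 'a::euclidean_space"
  assumes cont: "continuous_on {0..} Y" and bdd: "bounded (Y ` {0..})"
    and fin: "finite (omega_limit Y)"
  obtains y where "y \<in> omega_limit Y" "(Y \<longlongrightarrow> y) at_top"
proof -
  have "omega_limit Y \<noteq> {}"
    \<comment> \<open>With an empty limit set, \<open>Y\<close> would eventually lie in the empty
      open set.\<close>
    using omega_limit_open_eventually[OF bdd, of "{}"] by auto
  then obtain y where y: "y \<in> omega_limit Y" by auto
  obtain d where d: "0 < d" "\<And>z. z \<in> omega_limit Y \<Longrightarrow> z \<noteq> y \<Longrightarrow> d \<le> dist y z"
    using finite_set_avoid[OF fin, of y] by auto
  have "(Y \<longlongrightarrow> y) at_top"
  proof (rule tendstoI)
    fix \<epsilon> :: real assume "0 < \<epsilon>"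
    \<comment> \<open>Strictly below \<open>d\<close>, so that the remaining limit points lie
      outside the closed ball.\<close>
    define r where "r = min \<epsilon> (d / 2)"
    have r: "0 < r" "r \<le> \<epsilon>" "r < d" using d(1) \<open>0 < \<epsilon>\<close> by (auto simp: r_def)
    let ?U = "ball y r" and ?W = "- cball y r"
    have "omega_limit Y \<subseteq> ?U \<union> ?W" using d(2) r by force
    then have "\<forall>\<^sub>F \<tau> in at_top. Y \<tau> \<in> ?U \<union> ?W"
      by (intro omega_limit_open_eventually[OF bdd]) auto
    then obtain T where T: "0 \<le> T" "\<And>\<tau>. T \<le> \<tau> \<Longrightarrow> Y \<tau> \<in> ?U \<union> ?W"
      by (rule eventually_at_top_nonneg) blast
    have conn: "connected (Y ` {T..})"
      using T(1) by (intro connected_continuous_image continuous_on_subset[OF cont]) auto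
    obtain \<sigma> where \<sigma>: "filterlim \<sigma> at_top sequentially" "(\<lambda>n. Y (\<sigma> n)) \<longlonglongrightarrow> y"
      using y unfolding omega_limit_def by blast
    have "\<forall>\<^sub>F n in sequentially. T \<le> \<sigma> n \<and> dist (Y (\<sigma> n)) y < r"
      using tendstoD[OF \<sigma>(2) r(1)] \<sigma>(1)[unfolded filterlim_at_top, rule_format, of T]
      by (rule eventually_conj[rotated])
    then obtain n where "T \<le> \<sigma> n" "dist (Y (\<sigma> n)) y < r"
      using eventually_happens' sequentially_bot by blast
    then have "?U \<inter> Y ` {T..} \<noteq> {}" by (auto simp: dist_commute)
    moreover have "Y ` {T..} \<subseteq> ?U \<union> ?W" using T(2) by blast
    ultimately have "?W \<inter> Y ` {T..} = {}"
      using connectedD[OF conn, of ?U ?W] ball_subset_cball[of y r] by blast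
    then have "dist (Y \<tau>) y < \<epsilon>" if "T \<le> \<tau>" for \<tau>
    proof -
      have "Y \<tau> \<notin> ?W" using \<open>?W \<inter> Y ` {T..} = {}\<close> that by blast
      then show ?thesis using T(2)[OF that] r(2) by (auto simp: dist_commute)
    qed
    then show "\<forall>\<^sub>F \<tau> in at_top. dist (Y \<tau>) y < \<epsilon>"
      by (auto simp: eventually_at_top_linorder)
  qed
  with y that show ?thesis by blast
qed

section \<open>The reversed flow\<close>

lemma convex_affine_vimage:
  fixes q :: "'a::real_vector"
  assumes "convex H"
  shows "convex {m. l *\<^sub>R m + q \<in> H}"
proof (rule convexI)
  fix x y and u v :: real
  assume "x \<in> {m. l *\<^sub>R m + q \<in> H}" "y \<in> {m. l *\<^sub>R m + q \<in> H}" and uv: "0 \<le> u" "0 \<le> v" "u + v = 1"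
  then have "u *\<^sub>R (l *\<^sub>R x + q) + v *\<^sub>R (l *\<^sub>R y + q) \<in> H"
    by (intro convexD[OF assms]) auto
  moreover have "u *\<^sub>R (l *\<^sub>R x + q) + v *\<^sub>R (l *\<^sub>R y + q) = l *\<^sub>R (u *\<^sub>R x + v *\<^sub>R y) + (u + v) *\<^sub>R q"
    by (simp add: algebra_simps)
  ultimately show "u *\<^sub>R x + v *\<^sub>R y \<in> {m. l *\<^sub>R m + q \<in> H}" using uv by simp
qed

text \<open>The expression is affine in each argument, so hull membership is used one argument at a
  time. No sign of \<open>l\<close> or \<open>k\<close> enters, which matters for \<lambda> >
  1.\<close>

lemma convex_hull_combination_in_convex:
  fixes m1 m2 :: "'a::real_vector"
  assumes m: "m1 \<in> convex hull S1" "m2 \<in> convex hull S2" and H: "convex H"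
    and S: "\<And>a b. a \<in> S1 \<Longrightarrow> b \<in> S2 \<Longrightarrow> l *\<^sub>R a + k *\<^sub>R b \<in> H"
  shows "l *\<^sub>R m1 + k *\<^sub>R m2 \<in> H"
proof -
  have "l *\<^sub>R a + k *\<^sub>R m2 \<in> H" if "a \<in> S1" for a
  proof -
    have "convex hull S2 \<subseteq> {m. k *\<^sub>R m + l *\<^sub>R a \<in> H}"
      using S[OF that] by (intro hull_minimal convex_affine_vimage H) (auto simp: add.commute)
    then show ?thesis using m(2) by (auto simp: add.commute)
  qed
  then have "convex hull S1 \<subseteq> {m. l *\<^sub>R m + k *\<^sub>R m2 \<in> H}"
    by (intro hull_minimal convex_affine_vimage H) auto
  then show ?thesis using m(1) by auto
qed

text \<open>With \<kappa> = 1 / (4 T), the inverse temperature at t = T exp (- \<tau>) is \<kappa>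
  exp \<tau>. The derivative is one-sided at \<tau> = 0, which corresponds to the endpoint t =
  T.\<close>

locale reversed_flow =
  M1: weighted_atoms I1 w1 a1 + M2: weighted_atoms I2 w2 a2
  for I1 :: "'i set" and w1 and a1 :: "'i \<Rightarrow> 'a::euclidean_space"
    and I2 :: "'j set" and w2 and a2 :: "'j \<Rightarrow> 'a" +
  fixes lam \<kappa> :: real and Y :: "real \<Rightarrow> 'a"
  assumes \<kappa>_pos: "0 < \<kappa>"
    and ode: "0 \<le> \<tau> \<Longrightarrow> (Y has_vector_derivative (- 1/2) *\<^sub>R
      (Y \<tau> - (lam *\<^sub>R M1.mean (\<kappa> * exp \<tau>) (Y \<tau>) + (1 - lam) *\<^sub>R M2.mean (\<kappa> * exp \<tau>) (Y \<tau>))))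
      (at \<tau> within {0..})"
begin

definition centre :: "real \<Rightarrow> 'a" where
  "centre \<tau> = lam *\<^sub>R M1.mean (\<kappa> * exp \<tau>) (Y \<tau>) + (1 - lam) *\<^sub>R M2.mean (\<kappa> * exp \<tau>) (Y \<tau>)"

lemma Y_deriv: "0 \<le> \<tau> \<Longrightarrow> (Y has_vector_derivative (- 1/2) *\<^sub>R (Y \<tau> - centre \<tau>)) (at \<tau> within {0..})"
  unfolding centre_def by (rule ode)

lemma Y_continuous: "continuous_on {0..} Y"
  using Y_deriv by (auto simp: continuous_on_eq_continuous_within intro: has_vector_derivative_continuous)

section \<open>A priori bounds and energy dissipation\<close>

lemma centre_bounded: "\<exists>M. \<forall>\<tau>. norm (centre \<tau>) \<le> M"
proof -
  have "bounded (convex hull (a1 ` I1))" "bounded (convex hull (a2 ` I2))"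
    by (rule bounded_convex_hull, rule finite_imp_bounded, simp add: M1.finite_I M2.finite_I)+
  then obtain R1 R2 where R: "\<And>x. x \<in> convex hull (a1 ` I1) \<Longrightarrow> norm x \<le> R1"
      "\<And>x. x \<in> convex hull (a2 ` I2) \<Longrightarrow> norm x \<le> R2"
    unfolding bounded_iff by blast
  have "norm (centre \<tau>) \<le> \<bar>lam\<bar> * R1 + \<bar>1 - lam\<bar> * R2" for \<tau>
    unfolding centre_def
    by (rule order_trans[OF norm_triangle_ineq])
       (auto intro!: add_mono mult_left_mono R M1.mean_in_hull M2.mean_in_hull)
  then show ?thesis by blast
qed

lemma Y_bounded: "bounded (Y ` {0..})"
proof -
  obtain M where M: "\<And>\<tau>. norm (centre \<tau>) \<le> M" using centre_bounded by blast
  have "0 \<le> M" using order_trans[OF norm_ge_zero M[of 0]] .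
  have "norm (Y \<tau>) \<le> norm (Y 0) + M" if "0 \<le> \<tau>" for \<tau>
  proof -
    have "norm (exp (\<tau> / 2) *\<^sub>R (Y \<tau> - 0) - exp (0 / 2) *\<^sub>R (Y 0 - 0))
        \<le> M / (1 - 2 * 0) * (exp ((1/2 - 0) * \<tau>) - exp ((1/2 - 0) * 0))"
      by (rule relaxation_bound[OF Y_deriv]) (use that M in auto)
    then have "norm (exp (\<tau> / 2) *\<^sub>R Y \<tau>) \<le> norm (Y 0) + M * exp (\<tau> / 2)"
      using norm_triangle_sub[of "exp (\<tau> / 2) *\<^sub>R Y \<tau>" "Y 0"] \<open>0 \<le> M\<close>
      by (simp add: right_diff_distrib)
    also have "\<dots> \<le> exp (\<tau> / 2) * (norm (Y 0) + M)"
      using that mult_right_mono[of 1 "exp (\<tau> / 2)" "norm (Y 0)"] by (simp add: algebra_simps)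
    finally show ?thesis by simp
  qed
  then show ?thesis by (auto simp: bounded_iff)
qed

lemma Y_lipschitz: "\<exists>L. \<forall>\<sigma> \<tau>. 0 \<le> \<sigma> \<longrightarrow> \<sigma> \<le> \<tau> \<longrightarrow> norm (Y \<tau> - Y \<sigma>) \<le> L * (\<tau> - \<sigma>)"
proof -
  obtain M where M: "\<And>\<tau>. norm (centre \<tau>) \<le> M" using centre_bounded by blast
  obtain R where R: "\<And>\<tau>. 0 \<le> \<tau> \<Longrightarrow> norm (Y \<tau>) \<le> R" using Y_bounded by (auto simp: bounded_iff)
  have "norm (Y \<tau> - Y \<sigma>) \<le> (R + M) / 2 * norm (\<tau> - \<sigma>)" if "0 \<le> \<sigma>" "\<sigma> \<le> \<tau>" for \<sigma> \<tau>
  proof (rule differentiable_bound)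
    show "convex {0::real..}" by simp
    fix x :: real assume x: "x \<in> {0..}"
    then show "(Y has_derivative (\<lambda>h. h *\<^sub>R (- 1/2) *\<^sub>R (Y x - centre x))) (at x within {0..})"
      using Y_deriv[of x] by (simp add: has_vector_derivative_def)
    have "norm (Y x - centre x) \<le> R + M"
      using norm_triangle_ineq4[of "Y x" "centre x"] R[of x] M[of x] x by simp
    then show "onorm (\<lambda>h. h *\<^sub>R (- 1/2) *\<^sub>R (Y x - centre x)) \<le> (R + M) / 2"
      by (intro onorm_le) (auto simp: mult.commute mult_left_mono)
  qed (use that in auto)
  then show ?thesis by (auto intro!: exI[of _ "(R + M) / 2"])
qed

text \<open>Up to the integrable entropy defect, \<open>\<lambda> \<psi>\<^sub>1 + (1 - \<lambda>) \<psi>\<^sub>2\<close> with the softened squared distances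
  \<open>\<psi>\<^sub>i = - ln Z\<^sub>i / s\<close> dissipates along the flow; the term \<open>(B / \<kappa>) exp (- \<tau>)\<close> absorbs the defect.\<close>

lemma energy_dissipation:
  obtains H H' h where
    "\<And>\<tau>. 0 \<le> \<tau> \<Longrightarrow> (H has_real_derivative H' \<tau>) (at \<tau> within {0..})"
    "\<And>\<tau>. 0 \<le> \<tau> \<Longrightarrow> H' \<tau> \<le> - (norm (Y \<tau> - centre \<tau>))\<^sup>2"
    "\<And>\<tau>. 0 \<le> \<tau> \<Longrightarrow> h \<le> H \<tau>"
proof -
  obtain B1 where B1: "\<And>s x. 0 < s \<Longrightarrow> \<bar>M1.entropy_defect s x\<bar> \<le> B1"
    using M1.entropy_defect_bounded by blast
  obtain B2 where B2: "\<And>s x. 0 < s \<Longrightarrow> \<bar>M2.entropy_defect s x\<bar> \<le> B2"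
    using M2.entropy_defect_bounded by blast
  define B where "B = \<bar>lam\<bar> * B1 + \<bar>1 - lam\<bar> * B2"
  let ?s = "\<lambda>\<tau>. \<kappa> * exp \<tau>"
  let ?D = "\<lambda>\<tau>. lam * M1.entropy_defect (?s \<tau>) (Y \<tau>) + (1 - lam) * M2.entropy_defect (?s \<tau>) (Y \<tau>)"
  have s_pos: "0 < ?s \<tau>" for \<tau> using \<kappa>_pos by simp
  have D: "\<bar>?D \<tau>\<bar> \<le> B" for \<tau>
    unfolding B_def
    by (rule order_trans[OF abs_triangle_ineq])
       (auto simp: abs_mult intro!: add_mono mult_left_mono B1 B2 s_pos)
  define \<psi>1 where "\<psi>1 \<tau> = - ln (M1.Z (?s \<tau>) (Y \<tau>)) / ?s \<tau>" for \<tau>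
  define \<psi>2 where "\<psi>2 \<tau> = - ln (M2.Z (?s \<tau>) (Y \<tau>)) / ?s \<tau>" for \<tau>
  define H where "H \<tau> = lam * \<psi>1 \<tau> + (1 - lam) * \<psi>2 \<tau> + B / \<kappa> * exp (- \<tau>)" for \<tau>
  define H' where "H' \<tau> = - (norm (Y \<tau> - centre \<tau>))\<^sup>2 + (?D \<tau> - B) / ?s \<tau>" for \<tau>
  have "(H has_real_derivative H' \<tau>) (at \<tau> within {0..})" if \<tau>: "0 \<le> \<tau>" for \<tau>
  proof -
    let ?Y' = "(- 1/2) *\<^sub>R (Y \<tau> - centre \<tau>)"
    let ?d1 = "2 * ((Y \<tau> - M1.mean (?s \<tau>) (Y \<tau>)) \<bullet> ?Y') + M1.entropy_defect (?s \<tau>) (Y \<tau>) / ?s \<tau>"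
    let ?d2 = "2 * ((Y \<tau> - M2.mean (?s \<tau>) (Y \<tau>)) \<bullet> ?Y') + M2.entropy_defect (?s \<tau>) (Y \<tau>) / ?s \<tau>"
    have "(H has_real_derivative lam * ?d1 + (1 - lam) * ?d2 + B / \<kappa> * (- exp (- \<tau>))) (at \<tau> within {0..})"
      unfolding H_def \<psi>1_def \<psi>2_def
      by (intro DERIV_add DERIV_cmult M1.potential_has_derivative M2.potential_has_derivative Y_deriv \<tau> \<kappa>_pos)
         (auto intro!: derivative_eq_intros)
    moreover have "lam * ?d1 + (1 - lam) * ?d2 + B / \<kappa> * (- exp (- \<tau>)) = H' \<tau>"
    proof -
      have *: "B / \<kappa> * (- exp (- \<tau>)) = - B / ?s \<tau>" by (simp add: exp_minus field_simps)
      have "lam * (2 * ((Y \<tau> - M1.mean (?s \<tau>) (Y \<tau>)) \<bullet> ?Y')) + (1 - lam) * (2 * ((Y \<tau> - M2.mean (?s \<tau>) (Y \<tau>)) \<bullet> ?Y'))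
          = 2 * ((Y \<tau> - centre \<tau>) \<bullet> ?Y')"
        by (simp add: centre_def inner_diff_left inner_add_left algebra_simps)
      also have "\<dots> = - (norm (Y \<tau> - centre \<tau>))\<^sup>2"
        by (simp add: power2_norm_eq_inner)
      finally show ?thesis
        unfolding * H'_def by (simp only: distrib_left add_divide_distrib diff_divide_distrib times_divide_eq_right)
    qed
    ultimately show ?thesis by simp
  qed
  moreover have "H' \<tau> \<le> - (norm (Y \<tau> - centre \<tau>))\<^sup>2" for \<tau>
  proof -
    have "(?D \<tau> - B) / ?s \<tau> \<le> 0"
      using D[of \<tau>] s_pos[of \<tau>] by (intro divide_nonpos_pos) auto
    then show ?thesis by (simp add: H'_def)
  qed
  moreover have "\<exists>h. \<forall>\<tau>\<ge>0. h \<le> H \<tau>"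
  proof -
    obtain i j where i: "i \<in> I1" and j: "j \<in> I2" using M1.I_nonempty M2.I_nonempty by auto
    obtain R where R: "\<And>\<tau>. 0 \<le> \<tau> \<Longrightarrow> norm (Y \<tau>) \<le> R" using Y_bounded by (auto simp: bounded_iff)
    define Q1 where "Q1 = (R + norm (a1 i))\<^sup>2 + (- ln (w1 i)) / \<kappa>"
    define Q2 where "Q2 = (R + norm (a2 j))\<^sup>2 + (- ln (w2 j)) / \<kappa>"
    have *: "(norm (Y \<tau> - b))\<^sup>2 + (- ln v) / ?s \<tau> \<le> (R + norm b)\<^sup>2 + (- ln v) / \<kappa>"
      if "0 \<le> \<tau>" "0 < v" "v \<le> 1" for \<tau> b v
    proof (intro add_mono power_mono)
      show "norm (Y \<tau> - b) \<le> R + norm b"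
        using norm_triangle_ineq4[of "Y \<tau>" b] R[OF that(1)] by linarith
      show "(- ln v) / ?s \<tau> \<le> (- ln v) / \<kappa>"
        using that \<kappa>_pos by (intro divide_left_mono) auto
    qed simp
    have \<psi>1: "0 \<le> \<psi>1 \<tau>" "\<psi>1 \<tau> \<le> Q1" if "0 \<le> \<tau>" for \<tau>
      using M1.potential_bounds[OF s_pos[of \<tau>] i, of "Y \<tau>"] *[OF that M1.w_pos[OF i] M1.w_le_1[OF i], of "a1 i"]
      by (auto simp: \<psi>1_def Q1_def)
    have \<psi>2: "0 \<le> \<psi>2 \<tau>" "\<psi>2 \<tau> \<le> Q2" if "0 \<le> \<tau>" for \<tau>
      using M2.potential_bounds[OF s_pos[of \<tau>] j, of "Y \<tau>"] *[OF that M2.w_pos[OF j] M2.w_le_1[OF j], of "a2 j"]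
      by (auto simp: \<psi>2_def Q2_def)
    \<comment> \<open>The factor may have either sign: for \<lambda> > 1 the bound from below on the
      second term comes from the upper bound on \<open>\<psi>2\<close>.\<close>
    have lower: "- (\<bar>l\<bar> * Q) \<le> l * p" if "0 \<le> p" "p \<le> Q" for l p Q :: real
      using that mult_left_mono[of p Q "\<bar>l\<bar>"] abs_ge_minus_self[of "l * p"]
      by (simp add: abs_mult)
    have "0 \<le> B" using D[of 0] by linarith
    then have "0 \<le> B / \<kappa> * exp (- \<tau>)" for \<tau> using \<kappa>_pos by simp
    then have "- (\<bar>lam\<bar> * Q1) + - (\<bar>1 - lam\<bar> * Q2) \<le> H \<tau>" if "0 \<le> \<tau>" for \<tau>
      unfolding H_def using lower[OF \<psi>1[OF that], of lam] lower[OF \<psi>2[OF that], of "1 - lam"]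
      by (metis add.right_neutral add_mono)
    then show ?thesis by blast
  qed
  ultimately show ?thesis using that by blast
qed

text \<open>The energy decreases to its infimum, so the energy left after \<open>\<sigma> n\<close>
  tends to 0. The mean value theorem on a short window after \<open>\<sigma> n\<close> finds a time
  of small dissipation, and the Lipschitz bound keeps the same limit \<open>y\<close>.\<close>

lemma omega_limit_critical_sequence:
  assumes "y \<in> omega_limit Y"
  obtains s where "filterlim s at_top sequentially" "(\<lambda>n. Y (s n)) \<longlonglongrightarrow> y"
    "(\<lambda>n. centre (s n)) \<longlonglongrightarrow> y"
proof -
  obtain H H' h where H: "\<And>\<tau>. 0 \<le> \<tau> \<Longrightarrow> (H has_real_derivative H' \<tau>) (at \<tau> within {0..})"
    "\<And>\<tau>. 0 \<le> \<tau> \<Longrightarrow> H' \<tau> \<le> - (norm (Y \<tau> - centre \<tau>))\<^sup>2" "\<And>\<tau>. 0 \<le> \<tau> \<Longrightarrow> h \<le> H \<tau>"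
    using energy_dissipation by blast
  obtain L where L: "\<And>\<sigma> \<tau>. 0 \<le> \<sigma> \<Longrightarrow> \<sigma> \<le> \<tau> \<Longrightarrow> norm (Y \<tau> - Y \<sigma>) \<le> L * (\<tau> - \<sigma>)"
    using Y_lipschitz by blast
  obtain \<sigma> where \<sigma>: "filterlim \<sigma> at_top sequentially" "(\<lambda>n. Y (\<sigma> n)) \<longlonglongrightarrow> y"
    using assms by (auto simp: omega_limit_def)
  have mvt: "\<exists>x. \<alpha> < x \<and> x < \<beta> \<and> H \<beta> - H \<alpha> = (\<beta> - \<alpha>) * H' x" if "0 \<le> \<alpha>" "\<alpha> < \<beta>" for \<alpha> \<beta>
  proof -
    have "\<exists>x\<in>{\<alpha><..<\<beta>}. H \<beta> - H \<alpha> = (\<lambda>h. H' x * h) (\<beta> - \<alpha>)"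
    proof (rule mvt_simple[OF that(2)])
      fix x assume "\<alpha> \<le> x" "x \<le> \<beta>"
      then show "(H has_derivative (\<lambda>h. H' x * h)) (at x within {\<alpha>..\<beta>})"
        using H(1)[of x] that unfolding has_field_derivative_def
        by (auto intro: has_derivative_subset)
    qed
    then show ?thesis by (auto simp: mult.commute)
  qed
  have mono: "H \<beta> \<le> H \<alpha>" if "0 \<le> \<alpha>" "\<alpha> \<le> \<beta>" for \<alpha> \<beta>
  proof (cases "\<alpha> = \<beta>")
    case False
    then obtain x where x: "\<alpha> < x" "H \<beta> - H \<alpha> = (\<beta> - \<alpha>) * H' x"
      using mvt[of \<alpha> \<beta>] \<open>\<alpha> \<le> \<beta>\<close> \<open>0 \<le> \<alpha>\<close> by auto
    have "H' x \<le> 0" using H(2)[of x] x \<open>0 \<le> \<alpha>\<close> by (smt (verit) zero_le_power2)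
    then show ?thesis using x that by (smt (verit) mult_nonneg_nonpos)
  qed simp
  define h0 where "h0 = (INF \<tau>\<in>{0..}. H \<tau>)"
  have bb: "bdd_below (H ` {0..})" using H(3) by (auto intro!: bdd_belowI2[of _ h])
  have h0: "h0 \<le> H \<tau>" if "0 \<le> \<tau>" for \<tau>
    unfolding h0_def using that by (intro cINF_lower[OF bb]) auto
  define e where "e n = H (\<sigma> n) - h0" for n
  have e: "e \<longlonglongrightarrow> 0"
  proof (rule LIMSEQ_I)
    fix r :: real assume "0 < r"
    then have "h0 < h0 + r" by simp
    then obtain \<tau> where \<tau>: "0 \<le> \<tau>" "H \<tau> < h0 + r"
      unfolding h0_def using cINF_less_iff[OF _ bb, of "h0 + r"] by (auto simp: h0_def)
    have "\<forall>\<^sub>F n in sequentially. \<tau> \<le> \<sigma> n"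
      using \<sigma>(1) by (simp add: filterlim_at_top)
    then have "\<forall>\<^sub>F n in sequentially. norm (e n - 0) < r"
    proof eventually_elim
      case (elim n)
      then show ?case using mono[OF \<tau>(1) elim] \<tau> h0[of "\<sigma> n"] by (simp add: e_def)
    qed
    then show "\<exists>no. \<forall>n\<ge>no. norm (e n - 0) < r" by (simp add: eventually_sequentially)
  qed
  \<comment> \<open>Dissipation at the chosen time is at most \<open>e n / \<delta> n\<close>: a
    window of length at least \<open>sqrt (e n)\<close> makes this at most
    \<open>sqrt (e n)\<close>, and the second summand keeps the window nondegenerate when
    \<open>e n = 0\<close>.\<close>
  define \<delta> where "\<delta> n = sqrt (e n) + 1 / real (Suc n)" for n
  have "\<delta> \<longlonglongrightarrow> sqrt 0 + 0"
    unfolding \<delta>_def by (intro tendsto_add tendsto_real_sqrt e LIMSEQ_Suc lim_1_over_n)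
  then have \<delta>0: "\<delta> \<longlonglongrightarrow> 0" by simp
  have "\<exists>x. 0 \<le> \<sigma> n \<longrightarrow> \<sigma> n \<le> x \<and> x \<le> \<sigma> n + \<delta> n \<and> (norm (Y x - centre x))\<^sup>2 \<le> sqrt (e n)" for n
  proof (cases "0 \<le> \<sigma> n")
    case True
    have e0: "0 \<le> e n" using h0[OF True] by (simp add: e_def)
    have \<delta>: "0 < \<delta> n" unfolding \<delta>_def using e0 by (intro add_nonneg_pos) auto
    obtain x where x: "\<sigma> n < x" "x < \<sigma> n + \<delta> n" "H (\<sigma> n + \<delta> n) - H (\<sigma> n) = \<delta> n * H' x"
      using mvt[OF True, of "\<sigma> n + \<delta> n"] \<delta> by auto
    have "\<delta> n * (norm (Y x - centre x))\<^sup>2 \<le> \<delta> n * (- H' x)"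
      using H(2)[of x] x True \<delta> by (intro mult_left_mono) auto
    also have "\<dots> \<le> e n"
      using x(3) h0[of "\<sigma> n + \<delta> n"] True \<delta> by (simp add: e_def)
    also have "\<dots> = sqrt (e n) * sqrt (e n)" using e0 by simp
    also have "\<dots> \<le> \<delta> n * sqrt (e n)"
      using e0 by (intro mult_right_mono) (auto simp: \<delta>_def)
    finally have "(norm (Y x - centre x))\<^sup>2 \<le> sqrt (e n)" using \<delta> by simp
    then show ?thesis using x by (auto intro!: exI[of _ x])
  qed auto
  then obtain s where s: "\<And>n. 0 \<le> \<sigma> n \<Longrightarrow> \<sigma> n \<le> s n \<and> s n \<le> \<sigma> n + \<delta> n \<and>
      (norm (Y (s n) - centre (s n)))\<^sup>2 \<le> sqrt (e n)"
    by metis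
  have ev: "\<forall>\<^sub>F n in sequentially. 0 \<le> \<sigma> n"
    using \<sigma>(1) by (simp add: filterlim_at_top)
  have s_top: "filterlim s at_top sequentially"
    by (rule filterlim_at_top_mono[OF \<sigma>(1)]) (use ev s in \<open>auto elim: eventually_mono\<close>)
  have "(\<lambda>n. norm (Y (s n) - Y (\<sigma> n))) \<longlonglongrightarrow> 0"
  proof (rule tendsto_sandwich[OF _ _ tendsto_const])
    show "(\<lambda>n. \<bar>L\<bar> * \<delta> n) \<longlonglongrightarrow> 0" using tendsto_mult_left[OF \<delta>0, of "\<bar>L\<bar>"] by simp
    show "\<forall>\<^sub>F n in sequentially. norm (Y (s n) - Y (\<sigma> n)) \<le> \<bar>L\<bar> * \<delta> n"
      using ev
    proof eventually_elim
      case (elim n)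
      have "norm (Y (s n) - Y (\<sigma> n)) \<le> L * (s n - \<sigma> n)" using L s elim by auto
      also have "\<dots> \<le> \<bar>L\<bar> * \<delta> n" using s[OF elim] by (intro mult_mono) auto
      finally show ?case .
    qed
  qed auto
  then have Ys: "(\<lambda>n. Y (s n)) \<longlonglongrightarrow> y"
    using Lim_transform[OF \<sigma>(2), of "\<lambda>n. Y (s n)"] by (simp add: tendsto_norm_zero_iff)
  have "(\<lambda>n. norm (Y (s n) - centre (s n))) \<longlonglongrightarrow> 0"
  proof (rule tendsto_sandwich[OF _ _ tendsto_const])
    have "(\<lambda>n. sqrt (sqrt (e n))) \<longlonglongrightarrow> sqrt (sqrt 0)" by (intro tendsto_real_sqrt e)
    then show "(\<lambda>n. sqrt (sqrt (e n))) \<longlonglongrightarrow> 0" by simp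
    show "\<forall>\<^sub>F n in sequentially. norm (Y (s n) - centre (s n)) \<le> sqrt (sqrt (e n))"
      using ev
    proof eventually_elim
      case (elim n)
      show ?case by (rule real_le_rsqrt[OF s[OF elim, THEN conjunct2, THEN conjunct2]])
    qed
  qed auto
  then have "(\<lambda>n. norm (centre (s n) - Y (s n))) \<longlonglongrightarrow> 0"
    by (simp only: norm_minus_commute)
  then have "(\<lambda>n. centre (s n)) \<longlonglongrightarrow> y"
    using Lim_transform[OF Ys, of "\<lambda>n. centre (s n)"] by (simp add: tendsto_norm_zero_iff)
  with s_top Ys that show ?thesis by blast
qed

text \<open>For each \<open>z\<close> in this set, 2 (y - z) lies in the outer Clarke
  subdifferential at \<open>y\<close>; the fixed-point relation
  \<open>y \<in> hull_combinations y\<close> therefore gives outer criticality.\<close>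

definition hull_combinations :: "'a \<Rightarrow> 'a set" where
  "hull_combinations y = {lam *\<^sub>R m1 + (1 - lam) *\<^sub>R m2 | m1 m2.
     m1 \<in> convex hull (a1 ` M1.nearest y) \<and> m2 \<in> convex hull (a2 ` M2.nearest y)}"

lemma closed_hull_combinations: "closed (hull_combinations y)"
proof -
  let ?C1 = "convex hull (a1 ` M1.nearest y)" and ?C2 = "convex hull (a2 ` M2.nearest y)"
  have "compact ?C1" "compact ?C2"
    using finite_subset[OF M1.nearest_subset M1.finite_I] finite_subset[OF M2.nearest_subset M2.finite_I]
    by (auto intro: finite_imp_compact_convex_hull)
  then have "compact ((\<lambda>(p, q). lam *\<^sub>R p + (1 - lam) *\<^sub>R q) ` (?C1 \<times> ?C2))"
    unfolding split_beta by (intro compact_continuous_image compact_Times continuous_intros)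
  moreover have "(\<lambda>(p, q). lam *\<^sub>R p + (1 - lam) *\<^sub>R q) ` (?C1 \<times> ?C2) = hull_combinations y"
    unfolding hull_combinations_def by force
  ultimately show ?thesis by (metis compact_imp_closed)
qed

text \<open>Quantifying over all \<tau> with \<open>Y \<tau> = x\<close> lets one neighbourhood
  statement be pulled back both along a sequence of times and along \<tau> to infinity.\<close>

lemma centre_near_hull_combinations:
  "\<exists>K\<ge>0. \<forall>\<^sub>F x in nhds y. \<forall>\<tau>. Y \<tau> = x \<longrightarrow> (\<exists>z\<in>hull_combinations y. norm (centre \<tau> - z) \<le> K * exp (- \<tau>))"
proof -
  obtain K1 where K1: "K1 \<ge> 0" "\<forall>\<^sub>F x in nhds y. \<forall>s>0. \<exists>m\<in>convex hull (a1 ` M1.nearest y). norm (M1.mean s x - m) \<le> K1 / s"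
    using M1.mean_near_nearest_hull by blast
  obtain K2 where K2: "K2 \<ge> 0" "\<forall>\<^sub>F x in nhds y. \<forall>s>0. \<exists>m\<in>convex hull (a2 ` M2.nearest y). norm (M2.mean s x - m) \<le> K2 / s"
    using M2.mean_near_nearest_hull by blast
  define K where "K = (\<bar>lam\<bar> * K1 + \<bar>1 - lam\<bar> * K2) / \<kappa>"
  have "\<forall>\<^sub>F x in nhds y. \<forall>\<tau>. Y \<tau> = x \<longrightarrow> (\<exists>z\<in>hull_combinations y. norm (centre \<tau> - z) \<le> K * exp (- \<tau>))"
    using K1(2) K2(2)
  proof eventually_elim
    case (elim x)
    show ?case
    proof (intro allI impI)
      fix \<tau> assume Y: "Y \<tau> = x"
      let ?s = "\<kappa> * exp \<tau>"
      have s: "0 < ?s" using \<kappa>_pos by simp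
      obtain m1 m2 where m1: "m1 \<in> convex hull (a1 ` M1.nearest y)" "norm (M1.mean ?s x - m1) \<le> K1 / ?s"
        and m2: "m2 \<in> convex hull (a2 ` M2.nearest y)" "norm (M2.mean ?s x - m2) \<le> K2 / ?s"
        using elim s by meson
      have "centre \<tau> - (lam *\<^sub>R m1 + (1 - lam) *\<^sub>R m2) =
          lam *\<^sub>R (M1.mean ?s x - m1) + (1 - lam) *\<^sub>R (M2.mean ?s x - m2)"
        by (simp add: centre_def Y algebra_simps)
      also have "norm \<dots> \<le> \<bar>lam\<bar> * (K1 / ?s) + \<bar>1 - lam\<bar> * (K2 / ?s)"
        using m1(2) m2(2)
        by (intro order_trans[OF norm_triangle_ineq] add_mono; unfold norm_scaleR; intro mult_left_mono) auto
      also have "\<dots> = K * exp (- \<tau>)" by (simp add: K_def exp_minus divide_inverse algebra_simps)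
      finally show "\<exists>z\<in>hull_combinations y. norm (centre \<tau> - z) \<le> K * exp (- \<tau>)"
        using m1(1) m2(1) unfolding hull_combinations_def by blast
    qed
  qed
  moreover have "K \<ge> 0" unfolding K_def using K1 K2 \<kappa>_pos by auto
  ultimately show ?thesis by blast
qed

lemma omega_limit_in_hull_combinations:
  assumes "y \<in> omega_limit Y"
  shows "y \<in> hull_combinations y"
proof -
  obtain s where s: "filterlim s at_top sequentially" "(\<lambda>n. Y (s n)) \<longlonglongrightarrow> y" "(\<lambda>n. centre (s n)) \<longlonglongrightarrow> y"
    using omega_limit_critical_sequence[OF assms] by blast
  obtain K where K: "\<forall>\<^sub>F x in nhds y. \<forall>\<tau>. Y \<tau> = x \<longrightarrow> (\<exists>z\<in>hull_combinations y. norm (centre \<tau> - z) \<le> K * exp (- \<tau>))"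
    using centre_near_hull_combinations by blast
  have "\<forall>\<^sub>F n in sequentially. \<exists>z\<in>hull_combinations y. norm (centre (s n) - z) \<le> K * exp (- s n)"
    using eventually_compose_filterlim[OF K s(2)] by (rule eventually_mono) blast
  then obtain N where "\<And>n. n \<ge> N \<Longrightarrow> \<exists>z\<in>hull_combinations y. norm (centre (s n) - z) \<le> K * exp (- s n)"
    by (auto simp: eventually_sequentially)
  then obtain z where z: "\<And>n. n \<ge> N \<Longrightarrow> z n \<in> hull_combinations y"
      "\<And>n. n \<ge> N \<Longrightarrow> norm (centre (s n) - z n) \<le> K * exp (- s n)"
    by metis
  have "(\<lambda>n. exp (- s n)) \<longlonglongrightarrow> 0"
    by (rule filterlim_compose[OF exp_at_bot]) (simp add: filterlim_uminus_at_bot s(1))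
  then have "(\<lambda>n. K * exp (- s n)) \<longlonglongrightarrow> 0"
    using tendsto_mult_left[of "\<lambda>n. exp (- s n)" 0 sequentially K] by simp
  then have "(\<lambda>n. norm (centre (s n) - z n)) \<longlonglongrightarrow> 0"
    by (rule tendsto_sandwich[OF _ _ tendsto_const, rotated 2]) (use z(2) in \<open>auto simp: eventually_sequentially\<close>)
  then have "z \<longlonglongrightarrow> y"
    using Lim_transform[OF s(3), of z] by (simp add: tendsto_norm_zero_iff norm_minus_commute)
  then show ?thesis
    by (rule Lim_in_closed_set[OF closed_hull_combinations, rotated 2])
       (use z(1) in \<open>auto simp: eventually_sequentially\<close>)
qed

text \<open>The second hypothesis collapses \<open>hull_combinations y\<close> to the point
  \<open>y\<close>, so the distance of \<open>centre\<close> from \<open>y\<close> becomes O(exp (-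
  \<tau>)).\<close>

lemma convergence_rate:
  assumes lim: "(Y \<longlongrightarrow> y) at_top"
    and y: "\<And>i j. i \<in> M1.nearest y \<Longrightarrow> j \<in> M2.nearest y \<Longrightarrow> lam *\<^sub>R a1 i + (1 - lam) *\<^sub>R a2 j = y"
  shows "\<exists>C>0. \<forall>\<tau>\<ge>0. norm (Y \<tau> - y) \<le> C * exp (- \<tau> / 2)"
proof -
  have comb: "z = y" if zin: "z \<in> hull_combinations y" for z
  proof -
    obtain m1 m2 where z: "z = lam *\<^sub>R m1 + (1 - lam) *\<^sub>R m2"
      and m: "m1 \<in> convex hull (a1 ` M1.nearest y)" "m2 \<in> convex hull (a2 ` M2.nearest y)"
      using zin unfolding hull_combinations_def by blast
    have "lam *\<^sub>R m1 + (1 - lam) *\<^sub>R m2 \<in> {y}"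
      by (rule convex_hull_combination_in_convex[OF m]) (use y in auto)
    then show ?thesis using z by simp
  qed
  obtain K where K: "K \<ge> 0" "\<forall>\<^sub>F x in nhds y. \<forall>\<tau>. Y \<tau> = x \<longrightarrow> (\<exists>z\<in>hull_combinations y. norm (centre \<tau> - z) \<le> K * exp (- \<tau>))"
    using centre_near_hull_combinations by blast
  have "\<forall>\<^sub>F \<tau> in at_top. norm (centre \<tau> - y) \<le> K * exp (- \<tau>)"
    using eventually_compose_filterlim[OF K(2) lim] by (rule eventually_mono) (use comb in blast)
  then obtain T where T: "0 \<le> T" "\<And>\<tau>. T \<le> \<tau> \<Longrightarrow> norm (centre \<tau> - y) \<le> K * exp (- \<tau>)"
    by (rule eventually_at_top_nonneg) blast
  obtain R where R: "\<And>\<tau>. 0 \<le> \<tau> \<Longrightarrow> norm (Y \<tau>) \<le> R" using Y_bounded by (auto simp: bounded_iff)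
  \<comment> \<open>The first term controls the weighted distance up to \<open>T\<close>,
    \<open>K\<close> its growth afterwards, and 1 makes \<open>C\<close> positive.\<close>
  define C where "C = exp (T / 2) * (R + norm y) + K + 1"
  have R': "norm (Y \<tau> - y) \<le> R + norm y" if "0 \<le> \<tau>" for \<tau>
    using norm_triangle_ineq4[of "Y \<tau>" y] R[OF that] by linarith
  have R0: "0 \<le> R + norm y" using order_trans[OF norm_ge_zero R'[of 0]] by simp
  have "0 < C" unfolding C_def using K(1) R0 by (intro add_nonneg_pos add_nonneg_nonneg) auto
  have main: "exp (\<tau> / 2) * norm (Y \<tau> - y) \<le> C" if \<tau>: "0 \<le> \<tau>" for \<tau>
  proof (cases "\<tau> \<le> T")
    case True
    then have "exp (\<tau> / 2) * norm (Y \<tau> - y) \<le> exp (T / 2) * (R + norm y)"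
      using R'[OF \<tau>] R0 by (intro mult_mono) auto
    then show ?thesis using K(1) by (simp add: C_def)
  next
    case False
    \<comment> \<open>At p = 1 the prefactor is \<open>- K\<close> and the exponentials decay, so
      the growth is bounded uniformly in \<tau>.\<close>
    have "norm (exp (\<tau> / 2) *\<^sub>R (Y \<tau> - y) - exp (T / 2) *\<^sub>R (Y T - y))
        \<le> K / (1 - 2 * 1) * (exp ((1/2 - 1) * \<tau>) - exp ((1/2 - 1) * T))"
      by (rule relaxation_bound[OF Y_deriv]) (use T False in auto)
    also have "\<dots> = K * (exp (- T / 2) - exp (- \<tau> / 2))" by (simp add: algebra_simps)
    also have "\<dots> \<le> K * 1"
      using K(1) T(1) by (intro mult_left_mono) (auto intro: order_trans[OF _ exp_ge_zero] simp: diff_le_eq add_increasing2)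
    finally have "norm (exp (\<tau> / 2) *\<^sub>R (Y \<tau> - y)) \<le> norm (exp (T / 2) *\<^sub>R (Y T - y)) + K"
      using norm_triangle_sub[of "exp (\<tau> / 2) *\<^sub>R (Y \<tau> - y)" "exp (T / 2) *\<^sub>R (Y T - y)"] by simp
    also have "\<dots> \<le> exp (T / 2) * (R + norm y) + K"
      using R'[OF T(1)] by simp
    finally show ?thesis by (simp add: C_def)
  qed
  have "norm (Y \<tau> - y) \<le> C * exp (- \<tau> / 2)" if "0 \<le> \<tau>" for \<tau>
    using main[OF that] by (simp add: exp_minus field_simps)
  then show ?thesis using \<open>0 < C\<close> by blast
qed

end

section \<open>Local minimizers of the geometric potential\<close>

text \<open>The coefficients sum to 1, so the result is again a paraboloid of unit curvature, for
  every real \<open>l\<close>.\<close>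

lemma norm_power2_convex_combination:
  fixes x a b :: "'a::real_inner"
  shows "l * (norm (x - a))\<^sup>2 + (1 - l) * (norm (x - b))\<^sup>2 =
    (norm (x - (l *\<^sub>R a + (1 - l) *\<^sub>R b)))\<^sup>2 + l * (1 - l) * (norm (a - b))\<^sup>2"
  unfolding power2_norm_eq_inner by (simp add: inner_simps inner_commute algebra_simps)

context reversed_flow
begin

abbreviation "A1 \<equiv> a1 ` I1"
abbreviation "A2 \<equiv> a2 ` I2"

definition pair_centre :: "'i \<times> 'j \<Rightarrow> 'a" where
  "pair_centre p = lam *\<^sub>R a1 (fst p) + (1 - lam) *\<^sub>R a2 (snd p)"

definition pair_offset :: "'i \<times> 'j \<Rightarrow> real" where
  "pair_offset p = lam * (1 - lam) * (norm (a1 (fst p) - a2 (snd p)))\<^sup>2"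

lemma pair_piece:
  "(norm (x - pair_centre p))\<^sup>2 + pair_offset p =
    lam * (norm (x - a1 (fst p)))\<^sup>2 + (1 - lam) * (norm (x - a2 (snd p)))\<^sup>2"
  by (simp add: norm_power2_convex_combination pair_centre_def pair_offset_def)

lemma Phi_nearest:
  "i \<in> M1.nearest x \<Longrightarrow> j \<in> M2.nearest x \<Longrightarrow>
    Phi lam A1 A2 x = lam * (norm (x - a1 i))\<^sup>2 + (1 - lam) * (norm (x - a2 j))\<^sup>2"
  by (simp add: M1.nearest_def M2.nearest_def active_def Phi_def)

text \<open>With nonnegative weights, minimising over the two atoms separately is minimising over
  pairs.\<close>

lemma Phi_lower_envelope:
  assumes "0 \<le> lam" "lam \<le> 1"
  shows "lower_envelope (I1 \<times> I2) pair_centre pair_offset (Phi lam A1 A2)"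
  unfolding lower_envelope_def pair_piece
proof (intro allI conjI ballI)
  fix x and p :: "'i \<times> 'j" assume "p \<in> I1 \<times> I2"
  then have "sqdist A1 x \<le> (norm (x - a1 (fst p)))\<^sup>2" "sqdist A2 x \<le> (norm (x - a2 (snd p)))\<^sup>2"
    using M1.envelope M2.envelope by (auto simp: lower_envelope_def)
  then show "Phi lam A1 A2 x \<le> lam * (norm (x - a1 (fst p)))\<^sup>2 + (1 - lam) * (norm (x - a2 (snd p)))\<^sup>2"
    unfolding Phi_def using assms by (intro add_mono mult_left_mono) auto
next
  fix x
  obtain i j where "i \<in> M1.nearest x" "j \<in> M2.nearest x"
    using M1.nearest_nonempty M2.nearest_nonempty by blast
  then show "\<exists>p\<in>I1 \<times> I2. Phi lam A1 A2 x =
      lam * (norm (x - a1 (fst p)))\<^sup>2 + (1 - lam) * (norm (x - a2 (snd p)))\<^sup>2"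
    using M1.nearest_subset M2.nearest_subset by (intro bexI[of _ "(i, j)"]) (auto simp: Phi_nearest)
qed

lemma nearest_pair_active:
  assumes "i \<in> M1.nearest y" "j \<in> M2.nearest y"
  shows "(i, j) \<in> active (I1 \<times> I2) pair_centre pair_offset (Phi lam A1 A2) y"
  using assms M1.nearest_subset M2.nearest_subset
  by (auto simp: active_def pair_piece Phi_nearest)

lemma omega_limit_subset_Crit_out: "omega_limit Y \<subseteq> Crit_out lam A1 A2"
proof
  fix y assume "y \<in> omega_limit Y"
  then have "y \<in> hull_combinations y" by (rule omega_limit_in_hull_combinations)
  then obtain m1 m2 where y: "y = lam *\<^sub>R m1 + (1 - lam) *\<^sub>R m2"
    and m: "m1 \<in> convex hull (a1 ` M1.nearest y)" "m2 \<in> convex hull (a2 ` M2.nearest y)"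
    unfolding hull_combinations_def by blast
  have c: "2 *\<^sub>R (y - m1) \<in> clarke (sqdist A1) y" "2 *\<^sub>R (y - m2) \<in> clarke (sqdist A2) y"
    using convex_hull_centres_in_clarke[OF M1.envelope M1.finite_I]
      convex_hull_centres_in_clarke[OF M2.envelope M2.finite_I] m
    by (auto simp: M1.nearest_def M2.nearest_def)
  have "lam *\<^sub>R 2 *\<^sub>R (y - m1) + (1 - lam) *\<^sub>R 2 *\<^sub>R (y - m2) = 0"
  proof -
    have "lam *\<^sub>R 2 *\<^sub>R (y - m1) + (1 - lam) *\<^sub>R 2 *\<^sub>R (y - m2) = 2 *\<^sub>R (y - (lam *\<^sub>R m1 + (1 - lam) *\<^sub>R m2))"
      by (simp add: algebra_simps)
    then show ?thesis using y by simp
  qed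
  from c this[symmetric] have "0 \<in> clarke_outer lam A1 A2 y"
    unfolding clarke_outer_def by blast
  then show "y \<in> Crit_out lam A1 A2" by (simp add: Crit_out_def)
qed

text \<open>Every pair of nearest atoms is an active piece of \<Phi>, so
  \<open>hull_combinations y\<close> lies in the hull of the active pair centres and criticality
  holds for \<Phi> itself.\<close>

lemma omega_limit_subset_Crit:
  assumes "0 \<le> lam" "lam \<le> 1"
  shows "omega_limit Y \<subseteq> Crit lam A1 A2"
proof
  fix y assume "y \<in> omega_limit Y"
  then have "y \<in> hull_combinations y" by (rule omega_limit_in_hull_combinations)
  then obtain m1 m2 where y: "y = lam *\<^sub>R m1 + (1 - lam) *\<^sub>R m2"
    and m: "m1 \<in> convex hull (a1 ` M1.nearest y)" "m2 \<in> convex hull (a2 ` M2.nearest y)"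
    unfolding hull_combinations_def by blast
  let ?J = "active (I1 \<times> I2) pair_centre pair_offset (Phi lam A1 A2) y"
  have "lam *\<^sub>R m1 + (1 - lam) *\<^sub>R m2 \<in> convex hull (pair_centre ` ?J)"
  proof (rule convex_hull_combination_in_convex[OF m])
    fix a b assume "a \<in> a1 ` M1.nearest y" "b \<in> a2 ` M2.nearest y"
    then obtain i j where ij: "i \<in> M1.nearest y" "a = a1 i" "j \<in> M2.nearest y" "b = a2 j" by auto
    then have "lam *\<^sub>R a + (1 - lam) *\<^sub>R b = pair_centre (i, j)" by (simp add: pair_centre_def)
    then show "lam *\<^sub>R a + (1 - lam) *\<^sub>R b \<in> convex hull (pair_centre ` ?J)"
      using nearest_pair_active[OF ij(1,3)] by (auto intro: hull_inc)
  qed simp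
  then have "2 *\<^sub>R (y - y) \<in> clarke (Phi lam A1 A2) y"
    using convex_hull_centres_in_clarke[OF Phi_lower_envelope[OF assms] finite_cartesian_product[OF M1.finite_I M2.finite_I]]
    by (metis y)
  then show "y \<in> Crit lam A1 A2" by (simp add: Crit_def)
qed

lemma Min_loc_active_centre:
  assumes "0 \<le> lam" "lam \<le> 1" "y \<in> Min_loc lam A1 A2"
    "p \<in> active (I1 \<times> I2) pair_centre pair_offset (Phi lam A1 A2) y"
  shows "pair_centre p = y"
  using lower_envelope_local_min[OF Phi_lower_envelope[OF assms(1,2)] assms(4)] assms(3)
  by (simp add: Min_loc_def)

text \<open>All active pieces are centred at \<open>y\<close> and share their value there, hence
  coincide; near \<open>y\<close> the envelope is a single paraboloid.\<close>

lemma smooth_near_Min_loc: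
  assumes "0 \<le> lam" "lam \<le> 1" "y \<in> Min_loc lam A1 A2"
  shows "smooth_near (Phi lam A1 A2) y"
proof (rule smooth_near_quadratic)
  show "\<forall>\<^sub>F x in nhds y. Phi lam A1 A2 x = (norm (x - y))\<^sup>2 + Phi lam A1 A2 y"
    using lower_envelope_eventually_active[OF Phi_lower_envelope[OF assms(1,2)]
        finite_cartesian_product[OF M1.finite_I M2.finite_I], of y]
  proof eventually_elim
    case (elim x)
    then obtain p where p: "p \<in> active (I1 \<times> I2) pair_centre pair_offset (Phi lam A1 A2) y"
      "Phi lam A1 A2 x = (norm (x - pair_centre p))\<^sup>2 + pair_offset p" by blast
    moreover have "Phi lam A1 A2 y = pair_offset p"
      using p(1) Min_loc_active_centre[OF assms p(1)] by (simp add: active_def)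
    ultimately show ?case using Min_loc_active_centre[OF assms p(1)] by simp
  qed
qed

text \<open>For \<open>\<lambda> \<ge> 1\<close> the function \<open>\<lambda> \<bar>x - a\<^sub>i\<bar>\<^sup>2 + (1 - \<lambda>) d\<^sub>2(x)\<^sup>2\<close> is strongly convex, lies above
  \<open>\<Phi>\<close>, and touches it exactly where \<open>a\<^sub>i\<close> is nearest.\<close>

lemma Min_loc_less:
  assumes lam: "1 \<le> lam" and y: "y \<in> Min_loc lam A1 A2"
    and i: "i \<in> M1.nearest y" "i \<in> M1.nearest z" and "z \<noteq> y"
  shows "Phi lam A1 A2 y < Phi lam A1 A2 z"
proof (rule ccontr)
  assume "\<not> ?thesis"
  then have le: "Phi lam A1 A2 z \<le> Phi lam A1 A2 y" by simp
  define g where "g x = lam * (norm (x - a1 i))\<^sup>2 + (1 - lam) * sqdist A2 x" for x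
  have g_eq: "Phi lam A1 A2 y = g y" "Phi lam A1 A2 z = g z"
    using i by (auto simp: Phi_def g_def M1.nearest_def active_def)
  have Phi_le: "Phi lam A1 A2 x \<le> g x" for x
    using M1.envelope M1.nearest_subset i(1) lam
    by (auto simp: Phi_def g_def lower_envelope_def intro!: mult_left_mono)
  let ?p = "\<lambda>s. y + s *\<^sub>R (z - y)"
  have less: "g (?p s) < g y" if s: "0 < s" "s < 1" for s
  proof -
    have along: "(norm (?p s - b))\<^sup>2 = (1 - s) * (norm (y - b))\<^sup>2 + s * (norm (z - b))\<^sup>2
        - s * (1 - s) * (norm (z - y))\<^sup>2" for b
      unfolding power2_norm_eq_inner by (simp add: inner_simps inner_commute algebra_simps)
    obtain j where j: "j \<in> M2.nearest (?p s)" using M2.nearest_nonempty by blast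
    then have jI: "j \<in> I2" and "sqdist A2 (?p s) = (norm (?p s - a2 j))\<^sup>2"
      using M2.nearest_subset by (auto simp: M2.nearest_def active_def)
    moreover have "sqdist A2 y \<le> (norm (y - a2 j))\<^sup>2" "sqdist A2 z \<le> (norm (z - a2 j))\<^sup>2"
      using M2.envelope jI by (auto simp: lower_envelope_def)
    \<comment> \<open>Semiconcavity of the squared distance, from the atom nearest at the
      intermediate point. The factor 1 - \<lambda> \<le> 0 reverses it, and the quadratic defects,
      weighted by \<lambda> and 1 - \<lambda>, add up to exactly one copy.\<close>
    ultimately have d2: "(1 - s) * sqdist A2 y + s * sqdist A2 z - s * (1 - s) * (norm (z - y))\<^sup>2
        \<le> sqdist A2 (?p s)"
      using s along[of "a2 j"] mult_left_mono[of "sqdist A2 y" _ "1 - s"] mult_left_mono[of "sqdist A2 z" _ s]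
      by (smt (verit))
    have "g (?p s) \<le> lam * ((1 - s) * (norm (y - a1 i))\<^sup>2 + s * (norm (z - a1 i))\<^sup>2
        - s * (1 - s) * (norm (z - y))\<^sup>2)
      + (1 - lam) * ((1 - s) * sqdist A2 y + s * sqdist A2 z - s * (1 - s) * (norm (z - y))\<^sup>2)"
      unfolding g_def along using d2 lam by (intro add_left_mono mult_left_mono_neg) auto
    also have "\<dots> = (1 - s) * g y + s * g z - s * (1 - s) * (norm (z - y))\<^sup>2"
      by (simp add: g_def algebra_simps)
    also have "\<dots> < (1 - s) * g y + s * g z"
    proof -
      have "0 < s * (1 - s) * (norm (z - y))\<^sup>2"
        using s \<open>z \<noteq> y\<close> by (intro mult_pos_pos) auto
      then show ?thesis by linarith
    qed
    also have "\<dots> \<le> (1 - s) * g y + s * g y"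
      using le s g_eq by (intro add_left_mono mult_left_mono) auto
    finally show ?thesis by (simp add: algebra_simps)
  qed
  have p: "(?p \<longlongrightarrow> y) (at_right 0)"
    by (auto intro!: tendsto_eq_intros)
  have "\<forall>\<^sub>F x in nhds y. Phi lam A1 A2 y \<le> Phi lam A1 A2 x"
    using y by (simp add: Min_loc_def)
  then have "\<forall>\<^sub>F s in at_right 0. Phi lam A1 A2 y \<le> Phi lam A1 A2 (?p s)"
    by (rule eventually_compose_filterlim[OF _ p])
  moreover have "\<forall>\<^sub>F s in at_right (0::real). s < 1"
    by (rule eventually_at_right_field[THEN iffD2]) (auto intro!: exI[of _ 1])
  ultimately have "\<forall>\<^sub>F s in at_right (0::real). False"
    using eventually_at_right_less[of 0]
  proof eventually_elim
    case (elim s)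
    then show ?case using less[of s] Phi_le[of "?p s"] g_eq by linarith
  qed
  then show False by simp
qed

lemma finite_Min_loc:
  assumes "0 \<le> lam"
  shows "finite (Min_loc lam A1 A2)"
proof (cases "lam \<le> 1")
  case True
  have "Min_loc lam A1 A2 \<subseteq> pair_centre ` (I1 \<times> I2)"
  proof
    fix y assume y: "y \<in> Min_loc lam A1 A2"
    obtain i j where ij: "i \<in> M1.nearest y" "j \<in> M2.nearest y"
      using M1.nearest_nonempty M2.nearest_nonempty by blast
    then have "pair_centre (i, j) = y"
      using Min_loc_active_centre[OF assms True y] nearest_pair_active by blast
    then show "y \<in> pair_centre ` (I1 \<times> I2)"
      using ij M1.nearest_subset M2.nearest_subset by blast
  qed
  then show ?thesis
    by (rule finite_subset) (simp add: M1.finite_I M2.finite_I)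
next
  case False
  define k where "k y = (SOME i. i \<in> M1.nearest y)" for y
  have k: "k y \<in> M1.nearest y" for y
    unfolding k_def using M1.nearest_nonempty by (simp add: some_in_eq)
  \<comment> \<open>Two distinct minimizers with a common nearest atom would each lie strictly below
    the other.\<close>
  have "inj_on k (Min_loc lam A1 A2)"
  proof (rule inj_onI, rule ccontr)
    fix y z assume yz: "y \<in> Min_loc lam A1 A2" "z \<in> Min_loc lam A1 A2" "k y = k z" "y \<noteq> z"
    have "1 \<le> lam" using False by simp
    from Min_loc_less[OF this yz(1), of "k y" z] Min_loc_less[OF this yz(2), of "k y" y] yz k[of y] k[of z]
    show False by auto
  qed
  moreover have "k ` Min_loc lam A1 A2 \<subseteq> I1" using k M1.nearest_subset by blast
  ultimately show ?thesis using M1.finite_I by (rule inj_on_finite)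
qed

text \<open>Each active centre c contributes 2 (y - c) to the Clarke subdifferential, so a singleton
  forces all centres to coincide. Images are compared because different indices may carry the same
  atom.\<close>

lemma nearest_unique_off_ND:
  assumes "y \<notin> ND_pair A1 A2"
  shows "\<exists>b1 b2. a1 ` M1.nearest y = {b1} \<and> a2 ` M2.nearest y = {b2}"
proof -
  have *: "\<exists>b. c ` active I c (\<lambda>_. 0) f y = {b}"
    if env: "lower_envelope I c (\<lambda>_. 0) f" "finite I" and nd: "y \<notin> ND f" for I :: "'k set" and c :: "'k \<Rightarrow> 'a" and f
  proof -
    obtain v where v: "clarke f y = {v}" using nd by (auto simp: ND_def is_singleton_def)
    have "c i = y - (1/2) *\<^sub>R v" if i: "i \<in> active I c (\<lambda>_. 0) f y" for i
    proof -
      have "2 *\<^sub>R (y - c i) \<in> clarke f y"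
        using i by (intro convex_hull_centres_in_clarke[OF env] hull_inc) auto
      then have "v = 2 *\<^sub>R (y - c i)" using v by simp
      then show ?thesis by simp
    qed
    moreover have "active I c (\<lambda>_. 0) f y \<noteq> {}"
      using env(1) by (auto simp: lower_envelope_def active_def)
    ultimately have "c ` active I c (\<lambda>_. 0) f y = {y - (1/2) *\<^sub>R v}" by force
    then show ?thesis ..
  qed
  show ?thesis
    using *[OF M1.envelope M1.finite_I] *[OF M2.envelope M2.finite_I] assms
    unfolding ND_pair_def M1.nearest_def M2.nearest_def by blast
qed

lemma flow_converges:
  assumes "omega_limit Y \<subseteq> Min_loc lam A1 A2" and lam: "0 \<le> lam"
  obtains y where "y \<in> omega_limit Y" "y \<in> Min_loc lam A1 A2" "(Y \<longlongrightarrow> y) at_top"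
    "lam \<le> 1 \<Longrightarrow> smooth_near (Phi lam A1 A2) y"
    "lam \<le> 1 \<or> y \<notin> ND_pair A1 A2 \<Longrightarrow> \<exists>C>0. \<forall>\<tau>\<ge>0. norm (Y \<tau> - y) \<le> C * exp (- \<tau> / 2)"
proof -
  have "finite (omega_limit Y)"
    using finite_subset[OF assms(1) finite_Min_loc[OF lam]] .
  then obtain y where y: "y \<in> omega_limit Y" "(Y \<longlongrightarrow> y) at_top"
    by (rule omega_limit_finite_imp_tendsto[OF Y_continuous Y_bounded])
  have min: "y \<in> Min_loc lam A1 A2" using y(1) assms(1) by blast
  have "\<exists>C>0. \<forall>\<tau>\<ge>0. norm (Y \<tau> - y) \<le> C * exp (- \<tau> / 2)"
    if smooth: "lam \<le> 1 \<or> y \<notin> ND_pair A1 A2"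
  proof (rule convergence_rate[OF y(2)])
    fix i j assume ij: "i \<in> M1.nearest y" "j \<in> M2.nearest y"
    show "lam *\<^sub>R a1 i + (1 - lam) *\<^sub>R a2 j = y"
    proof (cases "lam \<le> 1")
      case True
      then show ?thesis
        using Min_loc_active_centre[OF lam True min nearest_pair_active[OF ij]] by (simp add: pair_centre_def)
    next
      case False
      then obtain b1 b2 where b: "a1 ` M1.nearest y = {b1}" "a2 ` M2.nearest y = {b2}"
        using smooth nearest_unique_off_ND by blast
      then have "a1 i = b1" "a2 j = b2" using ij by auto
      \<comment> \<open>Both hulls are single points here, so the fixed-point relation is already
        the required equation.\<close>
      moreover have "y = lam *\<^sub>R b1 + (1 - lam) *\<^sub>R b2"
        using omega_limit_in_hull_combinations[OF y(1)] unfolding hull_combinations_def b by auto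
      ultimately show ?thesis by simp
    qed
  qed
  with y min smooth_near_Min_loc[OF lam] that show ?thesis by blast
qed

end

section \<open>Convergence of the flow\<close>

text \<open>Since dt/d\<tau> = - t, the singular factor 1 / (2 t) becomes the constant -
  1/2.\<close>

lemma log_time_deriv:
  assumes X: "\<And>t. t \<in> {0<..T} \<Longrightarrow> (X has_vector_derivative (1 / (2 * t)) *\<^sub>R (X t - c t)) (at t within {0<..T})"
    and "0 < T" "0 \<le> \<tau>"
  shows "(log_time T X has_vector_derivative (- 1/2) *\<^sub>R (log_time T X \<tau> - c (T * exp (- \<tau>)))) (at \<tau> within {0..})"
proof -
  let ?t = "\<lambda>\<tau>. T * exp (- \<tau>)"
  have img: "?t ` {0..} \<subseteq> {0<..T}" using assms(2) by (auto simp: mult_le_cancel_left1)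
  have t: "?t \<tau> \<in> {0<..T}" using img assms(3) by auto
  have "(?t has_vector_derivative - ?t \<tau>) (at \<tau> within {0..})"
    unfolding has_real_derivative_iff_has_vector_derivative[symmetric]
    by (auto intro!: derivative_eq_intros)
  then have "((X \<circ> ?t) has_vector_derivative (- ?t \<tau>) *\<^sub>R ((1 / (2 * ?t \<tau>)) *\<^sub>R (X (?t \<tau>) - c (?t \<tau>)))) (at \<tau> within {0..})"
    by (rule vector_diff_chain_within)
       (rule has_vector_derivative_within_subset[OF X[OF t] img])
  moreover have "X \<circ> ?t = log_time T X" by (auto simp: log_time_def)
  ultimately show ?thesis using assms(2) by (simp add: log_time_def)
qed

lemma exp_rate_imp_sqrt_rate:
  assumes "0 < T" and C: "0 < C" "\<And>\<tau>. 0 \<le> \<tau> \<Longrightarrow> norm (log_time T X \<tau> - y) \<le> C * exp (- \<tau> / 2)"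
  shows "\<exists>C>0. \<forall>t\<in>{0<..T}. norm (X t - y) \<le> C * sqrt t"
proof (intro exI conjI ballI)
  \<comment> \<open>At \<tau> = ln (T / t), exp (- \<tau> / 2) equals
    \<open>sqrt t / sqrt T\<close>.\<close>
  show "0 < C / sqrt T" using assms by simp
  fix t assume t: "t \<in> {0<..T}"
  define \<tau> where "\<tau> = ln (T / t)"
  have "0 \<le> \<tau>" using t assms(1) by (auto simp: \<tau>_def)
  have e: "exp (- \<tau>) = t / T" using t assms(1) by (simp add: \<tau>_def exp_minus)
  have "exp (- \<tau> / 2) = sqrt (exp (- \<tau>))"
    by (rule sym, rule real_sqrt_unique) (auto simp: power2_eq_square simp flip: exp_add)
  then have "exp (- \<tau> / 2) = sqrt t / sqrt T" by (simp add: e real_sqrt_divide)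
  moreover have "log_time T X \<tau> = X t" using e assms(1) by (simp add: log_time_def)
  ultimately show "norm (X t - y) \<le> C / sqrt T * sqrt t"
    using C(2)[OF \<open>0 \<le> \<tau>\<close>] by simp
qed

theorem corollary3p20:
  fixes lam T :: real
    and \<mu>1 \<mu>2 :: "'a::euclidean_space measure"
    and A1 A2 :: "'a set"
    and xT :: 'a
    and X Y :: "real \<Rightarrow> 'a"
  assumes "0 \<le> lam" and "0 < T"
    and "finite_dirac_mixture \<mu>1" and "finite_dirac_mixture \<mu>2"
    and "A1 = supp \<mu>1" and "A2 = supp \<mu>2"
    and "solves_flow lam \<mu>1 \<mu>2 T X" and "X T = xT"
    and "Y = log_time T X"
    and "lam \<le> 1 \<Longrightarrow> omega_limit Y \<inter> (Crit lam A1 A2 - Min_loc lam A1 A2) = {}"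
    and "1 < lam \<Longrightarrow> omega_limit Y \<inter> (Crit_out lam A1 A2 - Min_loc lam A1 A2) = {}"
  shows "\<exists>xstar \<in> Min_loc lam A1 A2.
           (Y \<longlongrightarrow> xstar) at_top \<and>
           (lam \<le> 1 \<longrightarrow>
              smooth_near (Phi lam A1 A2) xstar \<and>
              (\<exists>C>0. \<forall>\<tau>\<ge>0. norm (Y \<tau> - xstar) \<le> C * exp (- \<tau> / 2)) \<and>
              (\<exists>C>0. \<forall>t\<in>{0<..T}. norm (X t - xstar) \<le> C * sqrt t)) \<and>
           (1 < lam \<and> xstar \<notin> ND_pair A1 A2 \<longrightarrow>
              (\<exists>C>0. \<forall>\<tau>\<ge>0. norm (Y \<tau> - xstar) \<le> C * exp (- \<tau> / 2)) \<and>
              (\<exists>C>0. \<forall>t\<in>{0<..T}. norm (X t - xstar) \<le> C * sqrt t))"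
proof -
  obtain I1 :: "nat set" and w1 a1 where M1: "weighted_atoms I1 w1" "supp \<mu>1 = a1 ` I1"
    "\<And>x t. heat_flow \<mu>1 x t = (\<Sum>i\<in>I1. w1 i * heat_kernel t (x - a1 i))"
    using finite_dirac_mixture_atoms[OF assms(3)] by blast
  obtain I2 :: "nat set" and w2 a2 where M2: "weighted_atoms I2 w2" "supp \<mu>2 = a2 ` I2"
    "\<And>x t. heat_flow \<mu>2 x t = (\<Sum>i\<in>I2. w2 i * heat_kernel t (x - a2 i))"
    using finite_dirac_mixture_atoms[OF assms(4)] by blast
  interpret M1: weighted_atoms I1 w1 a1 by (rule M1)
  interpret M2: weighted_atoms I2 w2 a2 by (rule M2)
  define c where "c t = lam *\<^sub>R M1.mean (1 / (4 * t)) (X t) + (1 - lam) *\<^sub>R M2.mean (1 / (4 * t)) (X t)" for t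
  have X: "(X has_vector_derivative (1 / (2 * t)) *\<^sub>R (X t - c t)) (at t within {0<..T})"
    if t: "t \<in> {0<..T}" for t
  proof -
    have "0 < t" using t by simp
    let ?m1 = "M1.mean (1 / (4 * t)) (X t)" and ?m2 = "M2.mean (1 / (4 * t)) (X t)"
    \<comment> \<open>The zero summands come from the product rule applied to the constant factors
      \<lambda> and 1 - \<lambda>.\<close>
    have "GDERIV (\<lambda>x. V lam \<mu>1 \<mu>2 x t) (X t) :>
        (lam *\<^sub>R (- 1 / (2 * t)) *\<^sub>R (X t - ?m1) + ln (heat_flow \<mu>1 (X t) t) *\<^sub>R 0) +
        ((1 - lam) *\<^sub>R (- 1 / (2 * t)) *\<^sub>R (X t - ?m2) + ln (heat_flow \<mu>2 (X t) t) *\<^sub>R 0)"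
      unfolding V_def
      by (intro GDERIV_add GDERIV_mult GDERIV_const
          GDERIV_ln_heat_flow[OF M1(1) \<open>0 < t\<close> M1(3)] GDERIV_ln_heat_flow[OF M2(1) \<open>0 < t\<close> M2(3)])
    then have "- grad (\<lambda>x. V lam \<mu>1 \<mu>2 x t) (X t) = - (lam *\<^sub>R (- 1 / (2 * t)) *\<^sub>R (X t - ?m1)
        + (1 - lam) *\<^sub>R (- 1 / (2 * t)) *\<^sub>R (X t - ?m2))"
      by (simp add: grad_eq)
    also have "\<dots> = (1 / (2 * t)) *\<^sub>R (X t - c t)"
    proof -
      have "- (lam *\<^sub>R (- k) *\<^sub>R (x - p) + (1 - lam) *\<^sub>R (- k) *\<^sub>R (x - q)) =
          k *\<^sub>R (x - (lam *\<^sub>R p + (1 - lam) *\<^sub>R q))" for k and x p q :: 'a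
        by (simp add: algebra_simps)
      then show ?thesis unfolding c_def minus_divide_left[symmetric] .
    qed
    finally show ?thesis
      using assms(7)[unfolded solves_flow_def, rule_format, OF t] by simp
  qed
  have inv: "1 / (4 * (T * exp (- \<tau>))) = 1 / (4 * T) * exp \<tau>" for \<tau>
    by (simp add: exp_minus field_simps)
  interpret F: reversed_flow I1 w1 a1 I2 w2 a2 lam "1 / (4 * T)" Y
  proof
    show "0 < 1 / (4 * T)" using assms(2) by simp
    fix \<tau> :: real assume "0 \<le> \<tau>"
    then show "(Y has_vector_derivative (- 1/2) *\<^sub>R
      (Y \<tau> - (lam *\<^sub>R M1.mean (1 / (4 * T) * exp \<tau>) (Y \<tau>) + (1 - lam) *\<^sub>R M2.mean (1 / (4 * T) * exp \<tau>) (Y \<tau>))))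
      (at \<tau> within {0..})"
      using log_time_deriv[OF X assms(2)] unfolding assms(9) c_def inv by (simp add: log_time_def)
  qed
  have "omega_limit Y \<subseteq> Min_loc lam A1 A2"
  proof (cases "lam \<le> 1")
    case True
    then show ?thesis using F.omega_limit_subset_Crit assms(1,10) unfolding assms(5,6) M1(2) M2(2) by blast
  next
    case False
    then show ?thesis using F.omega_limit_subset_Crit_out assms(11) unfolding assms(5,6) M1(2) M2(2) by auto
  qed
  then obtain y where y: "y \<in> Min_loc lam A1 A2" "(Y \<longlongrightarrow> y) at_top"
    "lam \<le> 1 \<Longrightarrow> smooth_near (Phi lam A1 A2) y"
    "lam \<le> 1 \<or> y \<notin> ND_pair A1 A2 \<Longrightarrow> \<exists>C>0. \<forall>\<tau>\<ge>0. norm (Y \<tau> - y) \<le> C * exp (- \<tau> / 2)"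
    using F.flow_converges assms(1) unfolding assms(5,6) M1(2) M2(2) by metis
  have "\<exists>C>0. \<forall>t\<in>{0<..T}. norm (X t - y) \<le> C * sqrt t" if "lam \<le> 1 \<or> y \<notin> ND_pair A1 A2"
    using y(4)[OF that] exp_rate_imp_sqrt_rate[OF assms(2)] unfolding assms(9) by blast
  with y show ?thesis by blast
qed

end
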